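(* Let $F_\alpha:M\to M$, $\alpha\in(0,1)$, be the family of solenoid maps with intermittency described in the context, with SRB measures $\eta_\alpha$. Let $\alpha_0\in(0,1)$ and let $(\alpha_n)_{n\ge1}$ be a sequence in $(0,1)$ with $\alpha_n\to\alpha_0$. Then for every continuous $\phi:M\to\mathbb R$, $$\lim_{n\to\infty}\int\phi\,d\eta_{\alpha_n}=\int\phi\,d\eta_{\alpha_0}.$$
   Context: $S^1=\mathbb R/\mathbb Z$, $\mathbb D$ is the closed unit disk in $\mathbb R^2$, $M=S^1\times\mathbb D$, $\pi:M\to S^1$ is the projection on the first factor. For $0<\alpha<1$, $f_\alpha:S^1\to S^1$ is the degree $2$ intermittent circle map (taken mod 1) $$f_\alpha(x)=\begin{cases}x(1+2^\alpha x^\alpha),&0\le x<\tfrac12,\\ x-2^\alpha(1-x)^{\alpha+1},&\tfrac12\le x\le1,\end{cases}$$ which has a unique absolutely continuous invariant probability (SRB) measure $\mu_\alpha$, and this measure is ergodic. The solenoid map with intermittency is $$F_\alpha(x,y,z)=\Big(f_\alpha(x),\ \tfrac12\cos(2\pi x)+\tfrac15y,\ \tfrac12\sin(2\pi x)+\tfrac15z\Big),\qquad (x,(y,z))\in M,$$ so that $f_\alpha\circ\pi=\pi\circ F_\alpha$. $\eta_\alpha$ denotes the $F_\alpha$-invariant Borel probability measure on $M$ with $\pi_*\eta_\alpha=\mu_\alpha$ (it is the unique SRB measure of $F_\alpha$). *)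

theory Defs
  imports "HOL-Probability.Probability"
begin

quotient_type circle = real / "\<lambda>x y. x - y \<in> \<int>"
  morphisms rep_circle circle_of
proof (rule equivpI)
  show "reflp (\<lambda>x y :: real. x - y \<in> \<int>)"
    by (simp add: reflp_def)
  show "symp (\<lambda>x y :: real. x - y \<in> \<int>)"
    unfolding symp_def using Ints_minus by fastforce
  show "transp (\<lambda>x y :: real. x - y \<in> \<int>)"
  proof (rule transpI)
    fix x y z :: real
    assume "x - y \<in> \<int>" "y - z \<in> \<int>"
    then have "(x - y) + (y - z) \<in> \<int>" by (rule Ints_add)
    then show "x - z \<in> \<int>" by simp
  qed
qed

lemma circle_of_eq_iff: "circle_of x = circle_of y \<longleftrightarrow> x - y \<in> \<int>"
  by (rule circle.abs_eq_iff)

instantiation circle :: topological_space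
begin

definition open_circle :: "circle set \<Rightarrow> bool" where
  "open_circle U \<longleftrightarrow> open (circle_of -` U)"

instance
  by standard (auto simp: open_circle_def vimage_Union)

end

lemma continuous_on_circle_of: "continuous_on UNIV circle_of"
  by (simp add: continuous_on_open_vimage open_circle_def)

text \<open>The representative in \<open>[0, 1)\<close> of a point of the circle.\<close>

lift_definition circle_coord :: "circle \<Rightarrow> real" is frac
proof -
  fix x y :: real
  assume "x - y \<in> \<int>"
  then obtain n where "x - y = of_int n" by (elim Ints_cases)
  then have "x = y + of_int n" by simp
  then show "frac x = frac y" by (simp add: frac_def)
qed

lemma circle_coord_ge_0: "0 \<le> circle_coord p" and circle_coord_less_1: "circle_coord p < 1"
  by (transfer, simp add: frac_lt_1)+

lemma circle_of_coord: "circle_of (circle_coord p) = p"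
  by (transfer, simp add: frac_def)

lemma circle_coord_of: "0 \<le> x \<Longrightarrow> x < 1 \<Longrightarrow> circle_coord (circle_of x) = x"
  by (simp add: circle_coord.abs_eq frac_eq)

definition circle_lebesgue :: "circle measure" where
  "circle_lebesgue = distr (restrict_space lborel {0..<1}) borel circle_of"

definition intermittent_branch :: "real \<Rightarrow> real \<Rightarrow> real" where
  "intermittent_branch a x =
    (if x < 1/2 then x * (1 + 2 powr a * x powr a)
     else x - 2 powr a * (1 - x) powr (a + 1))"

definition intermittent_map :: "real \<Rightarrow> circle \<Rightarrow> circle" where
  "intermittent_map a p = circle_of (intermittent_branch a (circle_coord p))"

lemma intermittent_map_circle_of:
  assumes "0 \<le> x" "x \<le> 1"
  shows "intermittent_map a (circle_of x) = circle_of (intermittent_branch a x)"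
proof (cases "x = 1")
  case True
  have "circle_of 1 = circle_of 0" by (simp add: circle_of_eq_iff)
  then show ?thesis
    using True circle_coord_of[of 0]
    by (simp add: intermittent_map_def intermittent_branch_def)
next
  case False
  then show ?thesis using assms by (simp add: intermittent_map_def circle_coord_of)
qed

text \<open>The norm of \<open>real \<times> real\<close> is Euclidean, so \<open>cball (0, 0) 1\<close> is the closed unit disk.\<close>

definition solid_torus :: "(circle \<times> real \<times> real) set" where
  "solid_torus = UNIV \<times> cball (0, 0) 1"

lemma mem_solid_torus: "(x, v) \<in> solid_torus \<longleftrightarrow> norm v \<le> 1"
  by (simp add: solid_torus_def flip: zero_prod_def)

fun solenoid_map :: "real \<Rightarrow> circle \<times> real \<times> real \<Rightarrow> circle \<times> real \<times> real" where
  "solenoid_map a (x, y, z) =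
    (intermittent_map a x,
     1/2 * cos (2 * pi * circle_coord x) + 1/5 * y,
     1/2 * sin (2 * pi * circle_coord x) + 1/5 * z)"

lemma fst_solenoid_map: "fst (solenoid_map a p) = intermittent_map a (fst p)"
  by (cases p) auto

lemma solenoid_map_in_solid_torus:
  assumes "p \<in> solid_torus"
  shows "solenoid_map a p \<in> solid_torus"
proof -
  obtain x y z where p: "p = (x, y, z)" by (cases p) auto
  define t where "t = 2 * pi * circle_coord x"
  have "(1/2 * cos t + 1/5 * y, 1/2 * sin t + 1/5 * z)
      = (1/2) *\<^sub>R (cos t, sin t) + (1/5) *\<^sub>R (y, z)" by simp
  then have "norm (1/2 * cos t + 1/5 * y, 1/2 * sin t + 1/5 * z)
      \<le> norm ((1/2) *\<^sub>R (cos t, sin t)) + norm ((1/5) *\<^sub>R (y, z))"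
    by (metis norm_triangle_ineq)
  also have "\<dots> = 1/2 * norm (cos t, sin t) + 1/5 * norm (y, z)"
    by (simp only: norm_scaleR)
  also have "norm (cos t, sin t) = 1" by (simp add: norm_Pair)
  finally have "norm (1/2 * cos t + 1/5 * y, 1/2 * sin t + 1/5 * z) \<le> 1/2 * 1 + 1/5 * norm (y, z)" .
  moreover have "norm (y, z) \<le> 1"
    using assms by (simp only: p mem_solid_torus)
  ultimately show ?thesis
    by (simp only: p solenoid_map.simps mem_solid_torus flip: t_def)
qed

definition invariant_measure :: "('a \<Rightarrow> 'a) \<Rightarrow> 'a measure \<Rightarrow> bool" where
  "invariant_measure T \<nu> \<longleftrightarrow> T \<in> measurable \<nu> \<nu> \<and> distr \<nu> \<nu> T = \<nu>"

definition acip :: "real \<Rightarrow> circle measure \<Rightarrow> bool" where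
  "acip a \<nu> \<longleftrightarrow> sets \<nu> = sets borel \<and> prob_space \<nu> \<and>
    absolutely_continuous circle_lebesgue \<nu> \<and> invariant_measure (intermittent_map a) \<nu>"

text \<open>For \<open>0 < a < 1\<close> the circle map has exactly one absolutely continuous invariant probability
  measure, its SRB measure; the SRB measure of the solenoid map is the invariant probability
  measure on the solid torus that projects to it.\<close>

definition circle_SRB :: "real \<Rightarrow> circle measure \<Rightarrow> bool" where
  "circle_SRB a \<nu> \<longleftrightarrow> acip a \<nu> \<and> (\<forall>\<nu>'. acip a \<nu>' \<longrightarrow> \<nu>' = \<nu>)"

definition solenoid_SRB :: "real \<Rightarrow> circle measure \<Rightarrow> (circle \<times> real \<times> real) measure \<Rightarrow> bool" where
  "solenoid_SRB a \<nu> \<theta> \<longleftrightarrow> sets \<theta> = sets (restrict_space borel solid_torus) \<and> prob_space \<theta> \<and>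
    invariant_measure (solenoid_map a) \<theta> \<and> distr \<theta> borel fst = \<nu>"

end

theory Submission
  imports Defs
begin

text \<open>
  Everything is transported to the interval \<open>[0, 1)\<close>.  The densities \<open>h\<close> that are symmetric under
  \<open>x \<mapsto> 1 - x\<close>, for which \<open>x\<^sup>2 h(x)\<close> is nondecreasing and \<open>h(y) \<le> 192 y\<^sup>-\<^sup>a\<close> on \<open>(0, 1/2]\<close>, form a class
  invariant under the transfer operator of the circle map.  The Cesaro averages of the iterates of
  Lebesgue measure therefore stay below a fixed integrable majorant, uniformly for parameters
  in \<open>(0, b]\<close> with \<open>b < 1\<close>, and by uniqueness so does the SRB measure.  A weak limit of measures below
  the majorant is absolutely continuous and does not see the discontinuities of the branches, so a limit
  of SRB measures is again absolutely continuous and invariant, hence is the SRB measure of the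
  limiting map.

  For the solenoid the fibres contract by \<open>1/5\<close>: up to an error uniform in the parameter, an
  observable can be replaced by its value at the \<open>m\<close>-th iterate of the centre of the fibre, a function
  of the base point that depends continuously on the parameter off a finite set.  This reduces the
  statement to the circle.
\<close>

section \<open>Branches and transfer operator\<close>

text \<open>The maximum extends the left branch by the identity to an increasing \<open>C\<^sup>1\<close> bijection of the line,
  which makes its inverse total and monotone and its derivative at 0 two-sided.\<close>

definition left_branch :: "real \<Rightarrow> real \<Rightarrow> real" where
  "left_branch a x = x * (1 + (2 * max 0 x) powr a)"

definition left_branch_deriv :: "real \<Rightarrow> real \<Rightarrow> real" where
  "left_branch_deriv a x = 1 + (1 + a) * (2 * max 0 x) powr a"

definition left_inverse :: "real \<Rightarrow> real \<Rightarrow> real" where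
  "left_inverse a = inv (left_branch a)"

lemma left_branch_0 [simp]: "left_branch a 0 = 0"
  by (simp add: left_branch_def)

lemma left_branch_half [simp]: "left_branch a (1/2) = 1"
  by (simp add: left_branch_def)

lemma left_branch_ge: "0 \<le> x \<Longrightarrow> x \<le> left_branch a x"
  by (simp add: left_branch_def mult_le_cancel_left1)

lemma left_branch_strict_mono:
  assumes "0 < a"
  shows "strict_mono (left_branch a)"
proof (rule strict_monoI)
  fix x y :: real
  assume xy: "x < y"
  show "left_branch a x < left_branch a y"
  proof (cases "0 \<le> x")
    case True
    then have "x * (1 + (2 * max 0 x) powr a) \<le> x * (1 + (2 * max 0 y) powr a)"
      using xy assms by (intro mult_left_mono add_left_mono powr_mono2) auto
    also have "\<dots> < y * (1 + (2 * max 0 y) powr a)"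
      using xy by (intro mult_strict_right_mono) (auto intro: add_pos_nonneg)
    finally show ?thesis by (simp add: left_branch_def)
  next
    case False
    then have "left_branch a x = x" by (simp add: left_branch_def)
    moreover have "y \<le> left_branch a y"
      by (cases "0 \<le> y") (auto simp: left_branch_ge, simp add: left_branch_def)
    ultimately show ?thesis using xy by simp
  qed
qed

lemma left_branch_less_iff:
  assumes "0 < a" shows "left_branch a x < left_branch a y \<longleftrightarrow> x < y"
  using left_branch_strict_mono[OF assms] by (simp add: strict_mono_less)

lemma left_branch_le_iff:
  assumes "0 < a" shows "left_branch a x \<le> left_branch a y \<longleftrightarrow> x \<le> y"
  using left_branch_strict_mono[OF assms] by (simp add: strict_mono_less_eq)

lemma continuous_on_left_branch:
  assumes "0 < a" shows "continuous_on S (left_branch a)"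
  unfolding left_branch_def using assms
  by (intro continuous_intros continuous_on_powr') auto

lemma continuous_on_left_branch_deriv:
  assumes "0 < a" shows "continuous_on S (left_branch_deriv a)"
  unfolding left_branch_deriv_def using assms
  by (intro continuous_intros continuous_on_powr') auto

lemma left_branch_deriv_ge_1: "0 < a \<Longrightarrow> 1 \<le> left_branch_deriv a x"
  by (simp add: left_branch_deriv_def)

lemma left_branch_deriv_mono:
  assumes "0 < a" "x \<le> y"
  shows "left_branch_deriv a x \<le> left_branch_deriv a y"
  unfolding left_branch_deriv_def using assms
  by (intro add_left_mono mult_left_mono powr_mono2) auto

lemma left_branch_has_deriv:
  assumes a: "0 < a"
  shows "(left_branch a has_real_derivative left_branch_deriv a x) (at x)"
proof -
  consider "x < 0" | "x = 0" | "0 < x" by linarith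
  then show ?thesis
  proof cases
    case 1
    have "((\<lambda>x. x) has_real_derivative 1) (at x)" by (rule DERIV_ident)
    then have "(left_branch a has_real_derivative 1) (at x)"
    proof (rule DERIV_cong_ev[THEN iffD1, rotated -1])
      have "\<forall>\<^sub>F x in nhds x. x < 0" using 1 eventually_nhds_in_open[of "{..<0}" x] by simp
      then show "\<forall>\<^sub>F x in nhds x. x = left_branch a x"
        by eventually_elim (simp add: left_branch_def)
    qed auto
    then show ?thesis using 1 by (simp add: left_branch_deriv_def)
  next
    case 2
    \<comment> \<open>The difference quotient at 0 is \<open>1 + (2 * max 0 h) powr a\<close>, which
      tends to 1 since \<open>0 < a\<close>: the fixed point 0 is neutral.\<close>
    have "((\<lambda>h. 1 + (2 * max 0 h) powr a) \<longlongrightarrow> 1 + (2 * max 0 0) powr a) (at (0::real))"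
      using a by (intro tendsto_intros tendsto_powr') auto
    then have "((\<lambda>h. left_branch a h / h) \<longlongrightarrow> 1) (at 0)"
      using a by (subst tendsto_cong[where g="\<lambda>h. 1 + (2 * max 0 h) powr a"])
        (auto simp: left_branch_def eventually_at intro: exI[of _ 1])
    then show ?thesis using 2 a by (simp add: DERIV_def left_branch_deriv_def)
  next
    case 3
    have "((\<lambda>x. x * (1 + (2 * x) powr a)) has_real_derivative
        (1 + (2 * x) powr a) + x * (a * (2 * x) powr (a - 1) * 2)) (at x)"
      using 3 by (auto intro!: derivative_eq_intros simp: powr_diff field_simps)
    moreover have "(1 + (2 * x) powr a) + x * (a * (2 * x) powr (a - 1) * 2) = left_branch_deriv a x"
      using 3 by (simp add: left_branch_deriv_def powr_diff field_simps)
    ultimately have "((\<lambda>x. x * (1 + (2 * x) powr a)) has_real_derivative left_branch_deriv a x) (at x)"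
      by simp
    then show ?thesis
    proof (rule DERIV_cong_ev[THEN iffD1, rotated -1])
      have "\<forall>\<^sub>F x in nhds x. 0 < x" using 3 eventually_nhds_in_open[of "{0<..}" x] by simp
      then show "\<forall>\<^sub>F x in nhds x. x * (1 + (2 * x) powr a) = left_branch a x"
        by eventually_elim (simp add: left_branch_def)
    qed auto
  qed
qed

lemma left_branch_surj:
  assumes a: "0 < a" shows "\<exists>x. left_branch a x = y"
proof (cases "0 \<le> y")
  case True
  then have "\<exists>x\<ge>0. x \<le> y \<and> left_branch a x = y"
    by (intro IVT') (auto simp: left_branch_ge continuous_on_left_branch[OF a])
  then show ?thesis by blast
next
  case False
  then have "left_branch a y = y" by (simp add: left_branch_def)
  then show ?thesis by blast
qed

lemma left_branch_inverse [simp]: "0 < a \<Longrightarrow> left_branch a (left_inverse a y) = y"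
  unfolding left_inverse_def using left_branch_surj[of a] by (metis surjI surj_f_inv_f)

lemma left_inverse_branch [simp]: "0 < a \<Longrightarrow> left_inverse a (left_branch a x) = x"
  unfolding left_inverse_def
  using left_branch_strict_mono[of a] by (simp add: strict_mono_imp_inj_on)

lemma left_inverse_le_iff: "0 < a \<Longrightarrow> left_inverse a y \<le> x \<longleftrightarrow> y \<le> left_branch a x"
  by (metis left_branch_inverse left_branch_le_iff)

lemma le_left_inverse_iff: "0 < a \<Longrightarrow> x \<le> left_inverse a y \<longleftrightarrow> left_branch a x \<le> y"
  by (metis left_branch_inverse left_branch_le_iff)

lemma left_inverse_mono: "0 < a \<Longrightarrow> mono (left_inverse a)"
  by (rule monoI) (simp add: left_inverse_le_iff)

lemma left_inverse_less_iff: "0 < a \<Longrightarrow> left_inverse a y < x \<longleftrightarrow> y < left_branch a x"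
  by (metis left_branch_inverse left_branch_less_iff)

lemma less_left_inverse_iff: "0 < a \<Longrightarrow> x < left_inverse a y \<longleftrightarrow> left_branch a x < y"
  by (metis left_branch_inverse left_branch_less_iff)

lemma left_inverse_bounds:
  assumes "0 < a" "0 < y" "y < 1"
  shows "0 < left_inverse a y" "left_inverse a y < 1/2"
  using assms by (simp_all add: left_inverse_less_iff less_left_inverse_iff del: less_divide_eq_numeral1)

lemma borel_measurable_left_inverse [measurable]:
  "0 < a \<Longrightarrow> left_inverse a \<in> borel_measurable borel"
  by (rule borel_measurable_mono[OF left_inverse_mono])

lemma borel_measurable_left_branch [measurable]: "left_branch a \<in> borel_measurable borel"
  unfolding left_branch_def by measurable

lemma borel_measurable_left_branch_deriv [measurable]: "left_branch_deriv a \<in> borel_measurable borel"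
  unfolding left_branch_deriv_def by measurable

section \<open>The circle map in the interval coordinate\<close>

lemma intermittent_branch_left:
  "0 \<le> x \<Longrightarrow> x < 1/2 \<Longrightarrow> intermittent_branch a x = left_branch a x"
  by (simp add: intermittent_branch_def left_branch_def powr_mult)

text \<open>Conjugation by the reflection \<open>1 - x\<close> exchanges the two branches. All facts
  on the right branch are therefore read off \<open>left_branch\<close>, and symmetric densities
  stay symmetric.\<close>

lemma intermittent_branch_right:
  "1/2 \<le> x \<Longrightarrow> x < 1 \<Longrightarrow> intermittent_branch a x = 1 - left_branch a (1 - x)"
  using powr_mult[of 2 "1 - x" a]
  by (simp add: intermittent_branch_def left_branch_def powr_add algebra_simps)

lemma borel_measurable_intermittent_branch [measurable]:
  "intermittent_branch a \<in> borel_measurable borel"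
  unfolding intermittent_branch_def[abs_def] by measurable

lemma intermittent_branch_range:
  assumes a: "0 < a" and x: "0 \<le> x" "x < 1"
  shows "0 \<le> intermittent_branch a x" "intermittent_branch a x < 1"
proof -
  have *: "0 \<le> left_branch a y" "y < 1/2 \<Longrightarrow> left_branch a y < 1" "y \<le> 1/2 \<Longrightarrow> left_branch a y \<le> 1"
    "0 < y \<Longrightarrow> 0 < left_branch a y"
    if "0 \<le> y" for y
    using left_branch_less_iff[OF a, of y "1/2"] left_branch_le_iff[OF a, of y "1/2"]
      left_branch_ge[OF that, of a] that by auto
  show "0 \<le> intermittent_branch a x" "intermittent_branch a x < 1"
    using *[of x] *[of "1 - x"] x
    by (cases "x < 1/2"; simp add: intermittent_branch_left intermittent_branch_right)+
qed

text \<open>The only interior point sent to 0 is \<open>1/2\<close>. Orbits that avoid it remain in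
  the open interval, where the map is continuous away from \<open>1/2\<close>.\<close>

lemma intermittent_branch_pos:
  assumes a: "0 < a" and x: "0 < x" "x < 1" "x \<noteq> 1/2"
  shows "0 < intermittent_branch a x"
proof (cases "x < 1/2")
  case True
  then show ?thesis using left_branch_ge[of x a] x by (simp add: intermittent_branch_left)
next
  case False
  then show ?thesis using left_branch_less_iff[OF a, of "1 - x" "1/2"] x
    by (simp add: intermittent_branch_right)
qed

text \<open>The Perron-Frobenius operator for Lebesgue measure: a sum over the two preimages of
  \<open>y\<close>, the second being the mirror image of the left preimage of \<open>1 - y\<close>,
  each weighted by the reciprocal of the slope there.\<close>

definition transfer_op :: "real \<Rightarrow> (real \<Rightarrow> real) \<Rightarrow> real \<Rightarrow> real" where
  "transfer_op a h y = (if 0 < y \<and> y < 1 then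
     h (left_inverse a y) / left_branch_deriv a (left_inverse a y) +
     h (1 - left_inverse a (1 - y)) / left_branch_deriv a (left_inverse a (1 - y)) else 0)"

lemma borel_measurable_transfer_op [measurable]:
  assumes "0 < a" and [measurable]: "h \<in> borel_measurable borel"
  shows "transfer_op a h \<in> borel_measurable borel"
proof -
  note [measurable] = borel_measurable_left_inverse[OF assms(1)]
  show ?thesis unfolding transfer_op_def[abs_def] by measurable
qed

lemma transfer_op_nonneg:
  assumes "0 < a" "\<And>x. 0 \<le> h x"
  shows "0 \<le> transfer_op a h y"
  using assms left_branch_deriv_ge_1[OF assms(1)] order_trans[OF zero_le_one]
  unfolding transfer_op_def by (auto intro!: add_nonneg_nonneg divide_nonneg_nonneg)


text \<open>The substitution \<open>y = left_branch a x\<close>; the Jacobian cancels the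
  denominator because the slope is at least 1.\<close>

lemma nn_integral_left_branch:
  fixes k :: "real \<Rightarrow> ennreal"
  assumes a: "0 < a" and [measurable]: "k \<in> borel_measurable borel"
  shows "(\<integral>\<^sup>+y\<in>{0<..<1}. k (left_inverse a y) / left_branch_deriv a (left_inverse a y) \<partial>lborel)
       = (\<integral>\<^sup>+x\<in>{0<..<1/2}. k x \<partial>lborel)"
proof -
  note [measurable] = borel_measurable_left_inverse[OF a]
  let ?F = "\<lambda>y. k (left_inverse a y) / left_branch_deriv a (left_inverse a y)"
  have D: "0 < left_branch_deriv a x" for x
    using left_branch_deriv_ge_1[OF a, of x] by simp
  have cancel: "c / ennreal (left_branch_deriv a x) * ennreal (left_branch_deriv a x) = c" for c x
    using D[of x] by (simp add: ennreal_divide_times ennreal_divide_self)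
  \<comment> \<open>Closing the interval adds a null set; its endpoints are written as images of 0
    and \<open>1/2\<close> to fit the substitution rule.\<close>
  have "(\<integral>\<^sup>+y\<in>{0<..<1}. ?F y \<partial>lborel) = (\<integral>\<^sup>+y. ?F y * indicator {left_branch a 0..left_branch a (1/2)} y \<partial>lborel)"
    by (intro nn_integral_cong_AE AE_I[of _ _ "{0,1}"]) (auto split: split_indicator simp: emeasure_lborel_countable)
  also have "\<dots> = (\<integral>\<^sup>+x. ?F (left_branch a x) * left_branch_deriv a x * indicator {0..1/2} x \<partial>lborel)"
    using a D by (intro nn_integral_substitution_aux left_branch_has_deriv continuous_on_left_branch_deriv)
      (auto simp: less_imp_le)
  also have "\<dots> = (\<integral>\<^sup>+x\<in>{0<..<1/2}. k x \<partial>lborel)"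
    using a by (intro nn_integral_cong_AE AE_I[of _ _ "{0,1/2}"])
      (auto split: split_indicator simp: emeasure_lborel_countable cancel)
  finally show ?thesis .
qed

text \<open>Identifies \<open>transfer_op\<close> as the action of the map on densities: split the
  integral at the null point \<open>1/2\<close> and change variables on each branch.\<close>

lemma distr_intermittent_branch:
  assumes a: "0 < a" and [measurable]: "h \<in> borel_measurable borel"
    and h: "\<And>x. 0 \<le> h x" and h0: "\<And>x. x \<notin> {0<..<1} \<Longrightarrow> h x = 0"
  shows "distr (density lborel h) borel (intermittent_branch a) = density lborel (transfer_op a h)"
proof (rule measure_eqI)
  note [measurable] = borel_measurable_left_inverse[OF a] borel_measurable_transfer_op[OF a]
  have D: "0 < left_branch_deriv a x" for x
    using left_branch_deriv_ge_1[OF a, of x] by simp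
  fix A assume "A \<in> sets (distr (density lborel (\<lambda>x. ennreal (h x))) borel (intermittent_branch a))"
  then have [measurable]: "A \<in> sets borel" by simp
  let ?T = "intermittent_branch a" and ?I = "left_inverse a" and ?D = "left_branch_deriv a"
  have "emeasure (distr (density lborel h) borel ?T) A = (\<integral>\<^sup>+x. ennreal (h x) * indicator A (?T x) \<partial>lborel)"
    by (subst emeasure_distr) (auto simp: emeasure_density measurable_sets_borel[OF borel_measurable_intermittent_branch] intro!: nn_integral_cong split: split_indicator)
  also have "\<dots> = (\<integral>\<^sup>+x. (ennreal (h x) * indicator A (left_branch a x)) * indicator {0<..<1/2} x +
      (ennreal (h x) * indicator A (1 - left_branch a (1 - x))) * indicator {1/2<..<1} x \<partial>lborel)"
    by (intro nn_integral_cong_AE AE_I[of _ _ "{1/2}"])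
       (auto split: split_indicator simp: intermittent_branch_left intermittent_branch_right h0 not_less)
  also have "\<dots> = (\<integral>\<^sup>+x\<in>{0<..<1/2}. (ennreal (h x) * indicator A (left_branch a x)) \<partial>lborel) +
      (\<integral>\<^sup>+x\<in>{1/2<..<1}. (ennreal (h x) * indicator A (1 - left_branch a (1 - x))) \<partial>lborel)"
    by (intro nn_integral_add) auto
  \<comment> \<open>Reflection turns the right half into an integral over the left half, so the same
    substitution applies; a second reflection restores the variable \<open>y\<close>.\<close>
  also have "(\<integral>\<^sup>+x\<in>{1/2<..<1}. (ennreal (h x) * indicator A (1 - left_branch a (1 - x))) \<partial>lborel) =
     (\<integral>\<^sup>+x\<in>{0<..<1/2}. (ennreal (h (1 - x)) * indicator A (1 - left_branch a x)) \<partial>lborel)"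
    by (subst nn_integral_real_affine[where c="-1" and t=1])
       (auto intro!: nn_integral_cong split: split_indicator)
  also have "\<dots> = (\<integral>\<^sup>+y\<in>{0<..<1}. (ennreal (h (1 - ?I y)) * indicator A (1 - y)) / ?D (?I y) \<partial>lborel)"
    using a by (subst nn_integral_left_branch[OF a, symmetric]) simp_all
  also have "\<dots> = (\<integral>\<^sup>+y\<in>{0<..<1}. (ennreal (h (1 - ?I (1 - y))) * indicator A y) / ?D (?I (1 - y)) \<partial>lborel)"
    by (subst nn_integral_real_affine[where c="-1" and t=1])
       (auto intro!: nn_integral_cong split: split_indicator)
  also have "(\<integral>\<^sup>+x\<in>{0<..<1/2}. (ennreal (h x) * indicator A (left_branch a x)) \<partial>lborel) = 
      (\<integral>\<^sup>+y\<in>{0<..<1}. (ennreal (h (?I y)) * indicator A y) / ?D (?I y) \<partial>lborel)"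
    using a by (subst nn_integral_left_branch[OF a, symmetric]) simp_all
  also have "\<dots> + (\<integral>\<^sup>+y\<in>{0<..<1}. (ennreal (h (1 - ?I (1 - y))) * indicator A y) / ?D (?I (1 - y)) \<partial>lborel)
     = (\<integral>\<^sup>+y. ((ennreal (h (?I y)) * indicator A y) / ?D (?I y)) * indicator {0<..<1} y
        + ((ennreal (h (1 - ?I (1 - y))) * indicator A y) / ?D (?I (1 - y))) * indicator {0<..<1} y \<partial>lborel)"
    by (intro nn_integral_add[symmetric]) auto
  also have "\<dots> = (\<integral>\<^sup>+y. ennreal (transfer_op a h y) * indicator A y \<partial>lborel)"
    using h D by (intro nn_integral_cong)
      (auto split: split_indicator simp: transfer_op_def divide_ennreal ennreal_plus less_imp_le)
  also have "\<dots> = emeasure (density lborel (transfer_op a h)) A"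
    by (simp add: emeasure_density assms)
  finally show "emeasure (distr (density lborel h) borel ?T) A = emeasure (density lborel (transfer_op a h)) A" .
qed simp

section \<open>An invariant class of densities\<close>

text \<open>The exponent 2 could be any number that is at least \<open>1 + a\<close>; 2 serves all parameters below 1
  simultaneously.  The constant 192 is 6 times the bound 32 on \<open>[1/4, 1/2]\<close> proved below, the factor 6
  being the one lost in \<open>powr_supersolution\<close>.\<close>

definition density_cone :: "real \<Rightarrow> (real \<Rightarrow> real) \<Rightarrow> bool" where
  "density_cone a h \<longleftrightarrow> h \<in> borel_measurable borel \<and> (\<forall>x. 0 \<le> h x) \<and>
    (\<forall>x. x \<notin> {0<..<1} \<longrightarrow> h x = 0) \<and> (\<forall>x. h (1 - x) = h x) \<and>
    (\<forall>x y. 0 < x \<longrightarrow> x \<le> y \<longrightarrow> y < 1 \<longrightarrow> x\<^sup>2 * h x \<le> y\<^sup>2 * h y) \<and>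
    (\<integral>\<^sup>+x. h x \<partial>lborel) = 1 \<and>
    (\<forall>y. 0 < y \<longrightarrow> y \<le> 1/2 \<longrightarrow> h y \<le> 192 * y powr (- a))"

lemma density_cone_indicator:
  assumes "0 < a"
  shows "density_cone a (indicator {0<..<1})"
proof -
  have "1 \<le> 192 * y powr (- a)" if "0 < y" "y \<le> 1/2" for y :: real
  proof -
    have "1 \<le> y powr (- a)"
      using that assms powr_mono2'[of "- a" y 1] by simp
    then show ?thesis by simp
  qed
  then show ?thesis
    by (auto simp: density_cone_def split: split_indicator
        simp: ennreal_indicator intro: power_mono)
qed

text \<open>With \<open>s = (2 * x) powr a\<close> and \<open>c = 1 + a\<close>, this is the factor
  that the left branch puts in front of \<open>x\<^sup>2 * h x\<close>. After cross-multiplication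
  the difference splits off \<open>t - s\<close>, and \<open>c \<le> 2\<close> makes the cofactor
  nonnegative.\<close>

lemma branch_ratio_mono:
  fixes s t c :: real
  assumes "0 \<le> s" "s \<le> t" "0 \<le> c" "c \<le> 2"
  shows "(1 + s)\<^sup>2 / (1 + c * s) \<le> (1 + t)\<^sup>2 / (1 + c * t)"
proof -
  have "(1 + t)\<^sup>2 * (1 + c * s) - (1 + s)\<^sup>2 * (1 + c * t) = (t - s) * (2 - c + s + t + c * (s * t))"
    by (simp add: power2_eq_square algebra_simps)
  also have "0 \<le> \<dots>" using assms by (intro mult_nonneg_nonneg add_nonneg_nonneg) auto
  finally have "(1 + s)\<^sup>2 * (1 + c * t) \<le> (1 + t)\<^sup>2 * (1 + c * s)" by simp
  moreover have "0 < 1 + c * s" "0 < 1 + c * t" using assms by (auto intro: add_pos_nonneg)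
  ultimately show ?thesis by (simp add: divide_simps mult.commute)
qed

text \<open>Monotonicity of \<open>x\<^sup>2 * h x\<close> carries the value at \<open>x\<close> to
  all of \<open>(1/2, 1)\<close>, an interval of length \<open>1/2\<close> with mass at most 1.
  Hence \<open>x\<^sup>2 * h x \<le> 2\<close>, and \<open>1/4 \<le> x\<close> yields 32.\<close>

lemma cone_bound_middle:
  assumes "density_cone a h" "1/4 \<le> x" "x \<le> 1/2"
  shows "h x \<le> 32"
proof -
  have h: "h \<in> borel_measurable borel" "\<And>x. 0 \<le> h x" "(\<integral>\<^sup>+x. h x \<partial>lborel) = 1"
    and mono: "\<And>t. x \<le> t \<Longrightarrow> t < 1 \<Longrightarrow> x\<^sup>2 * h x \<le> t\<^sup>2 * h t"
    using assms by (auto simp: density_cone_def)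
  have "ennreal (x\<^sup>2 * h x / 2) = (\<integral>\<^sup>+t\<in>{1/2<..<1::real}. ennreal (x\<^sup>2 * h x) \<partial>lborel)"
  proof -
    have "(\<integral>\<^sup>+t\<in>{1/2<..<1::real}. ennreal (x\<^sup>2 * h x) \<partial>lborel) = ennreal (x\<^sup>2 * h x) * ennreal (1/2)"
      by (subst nn_integral_cmult_indicator) (auto simp del: ennreal_half)
    also have "\<dots> = ennreal (x\<^sup>2 * h x * (1/2))" using h(2)[of x] by (intro ennreal_mult[symmetric]) auto
    finally show ?thesis by simp
  qed
  also have "\<dots> \<le> (\<integral>\<^sup>+t. h t \<partial>lborel)"
  proof (intro nn_integral_mono)
    fix t :: real
    have "x\<^sup>2 * h x \<le> h t" if "1/2 < t" "t < 1"
    proof -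
      have "x\<^sup>2 * h x \<le> t\<^sup>2 * h t" using that assms by (intro mono) auto
      also have "\<dots> \<le> 1 * h t" using that h(2) by (intro mult_right_mono) (auto simp: power_le_one)
      finally show ?thesis by simp
    qed
    then show "ennreal (x\<^sup>2 * h x) * indicator {1/2<..<1} t \<le> ennreal (h t)"
      by (auto split: split_indicator intro: ennreal_leI)
  qed
  also have "\<dots> = 1" by (rule h)
  finally have "x\<^sup>2 * h x / 2 \<le> 1" by (simp flip: ennreal_1)
  moreover have "(1/4)\<^sup>2 * h x \<le> x\<^sup>2 * h x"
    using assms h(2) by (intro mult_right_mono power_mono) auto
  ultimately show ?thesis by (simp add: power2_eq_square)
qed

text \<open>With \<open>s = (2 x)\<^sup>a\<close> and \<open>y = x (1 + s)\<close>, multiplication by \<open>x\<^sup>-\<^sup>a\<close> turns this into the statement that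
  \<open>y\<^sup>-\<^sup>a\<close> exceeds its image under the left half of the transfer operator by at least \<open>1/6\<close>,
  which pays for the bounded right half.\<close>

lemma powr_supersolution:
  fixes a s :: real
  assumes "0 < a" "a < 1" "0 < s" "s \<le> 1"
  shows "1 / (1 + (1 + a) * s) + s / 6 \<le> (1 + s) powr (- a)"
proof -
  have "(1 + s) powr a \<le> 1 + a * s"
  proof -
    \<comment> \<open>Bernoulli's inequality, obtained as the weighted inequality between geometric
      and arithmetic mean of \<open>1 + s\<close> and 1.\<close>
    have "(1 + s) powr a * 1 powr (1 - a) \<le> a * (1 + s) + (1 - a) * 1"
      using assms by (intro Youngs_inequality_0) auto
    then show ?thesis by (simp add: algebra_simps)
  qed
  then have "1 / (1 + a * s) \<le> (1 + s) powr (- a)"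
    using assms by (simp add: powr_minus_divide frac_le)
  moreover have "s / 6 \<le> 1 / (1 + a * s) - 1 / (1 + (1 + a) * s)"
  proof -
    have pos: "0 < 1 + a * s" "0 < 1 + (1 + a) * s" using assms by (auto intro: add_pos_pos)
    have as: "a * s \<le> 1" using assms by (intro mult_le_one) auto
    \<comment> \<open>The origin of the factor 6: the product of the two denominators is at most
      \<open>2 * 3\<close>.\<close>
    have "(1 + a * s) * (1 + (1 + a) * s) \<le> 2 * 3"
      using pos as assms by (intro mult_mono) (auto simp: algebra_simps)
    then have "s / 6 \<le> s / ((1 + a * s) * (1 + (1 + a) * s))"
      using pos assms by (intro divide_left_mono) auto
    also have "\<dots> = 1 / (1 + a * s) - 1 / (1 + (1 + a) * s)"
      using pos by (simp add: field_simps)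
    finally show ?thesis .
  qed
  ultimately show ?thesis by linarith
qed

text \<open>The left preimage \<open>x\<close> of \<open>y\<close> inherits the singular bound,
  while the right preimage \<open>1 - z\<close> stays away from the neutral fixed point and
  contributes at most 32. The surplus in \<open>powr_supersolution\<close> absorbs this
  constant.\<close>

lemma transfer_op_bound:
  assumes a: "0 < a" "a < 1" and h: "density_cone a h" and y: "0 < y" "y \<le> 1/2"
  shows "transfer_op a h y \<le> 192 * y powr (- a)"
proof -
  define x where "x = left_inverse a y"
  define z where "z = left_inverse a (1 - y)"
  define s where "s = (2 * x) powr a"
  have h0: "\<And>x. 0 \<le> h x" and hb: "\<And>y. 0 < y \<Longrightarrow> y \<le> 1/2 \<Longrightarrow> h y \<le> 192 * y powr (- a)"
    and sym: "\<And>x. h (1 - x) = h x"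
    using h by (auto simp: density_cone_def)
  have x: "0 < x" "x < 1/2" using left_inverse_bounds[OF a(1), of y] y by (auto simp: x_def)
  have yx: "y = x * (1 + s)"
    using left_branch_inverse[OF a(1), of y] x unfolding x_def[symmetric] by (simp add: left_branch_def s_def)
  have s: "0 < s" "s \<le> 1" using x a powr_mono2[of a "2 * x" 1] by (auto simp: s_def)
  have D: "left_branch_deriv a x = 1 + (1 + a) * s"
    using x by (simp add: left_branch_deriv_def s_def)
  have z: "1/4 \<le> z" "z \<le> 1/2"
  proof -
    have "(1/2) powr a \<le> (1::real)" using a by (intro powr_le1) auto
    \<comment> \<open>The value is \<open>1/4 * (1 + (1/2) powr a)\<close>, hence at most
      \<open>1/2\<close>, whereas \<open>1 - y\<close> is at least \<open>1/2\<close>.\<close>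
    then have "left_branch a (1/4) \<le> 1 - y" using y by (simp add: left_branch_def)
    then show "1/4 \<le> z" using a unfolding z_def by (subst le_left_inverse_iff)
    show "z \<le> 1/2" using left_inverse_bounds[OF a(1), of "1 - y"] y by (auto simp: z_def)
  qed
  have "h (1 - z) / left_branch_deriv a z \<le> 32 / 1"
    using cone_bound_middle[OF h z] sym[of z] h0 left_branch_deriv_ge_1[OF a(1), of z]
    by (intro frac_le) auto
  moreover have "h x / left_branch_deriv a x \<le> 192 * x powr (- a) / (1 + (1 + a) * s)"
    unfolding D using hb[of x] x s a by (intro divide_right_mono) auto
  ultimately have "transfer_op a h y \<le> 192 * x powr (- a) / (1 + (1 + a) * s) + 32"
    using y by (simp add: transfer_op_def x_def z_def)
  \<comment> \<open>The powers of \<open>x\<close> cancel in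
    \<open>x powr (- a) * s = 2 powr a\<close>, which is at least 1, and
    \<open>192 / 6 = 32\<close>.\<close>
  also have "32 \<le> 192 * x powr (- a) * (s / 6)"
  proof -
    have "x powr (- a) * s = 2 powr a"
      using x by (simp add: s_def powr_mult powr_minus field_simps)
    moreover have "1 \<le> 2 powr a" using a by (simp add: ge_one_powr_ge_zero)
    ultimately show ?thesis by (simp add: mult.commute)
  qed
  also have "192 * x powr (- a) / (1 + (1 + a) * s) + 192 * x powr (- a) * (s / 6) =
     192 * x powr (- a) * (1 / (1 + (1 + a) * s) + s / 6)" by (simp add: algebra_simps)
  also have "\<dots> \<le> 192 * x powr (- a) * (1 + s) powr (- a)"
    using powr_supersolution[OF a s] by (intro mult_left_mono) auto
  also have "\<dots> = 192 * y powr (- a)" using x s by (simp add: yx powr_mult)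
  finally show ?thesis by simp
qed

text \<open>The two summands are monotone separately. As \<open>y\<close> grows, both preimages move
  to the right, so \<open>z\<close>, the distance of the right one from 1, shrinks.\<close>

lemma transfer_op_mono:
  assumes a: "0 < a" "a < 1" and h: "density_cone a h" and y: "0 < y" "y \<le> y'" "y' < 1"
  shows "y\<^sup>2 * transfer_op a h y \<le> y'\<^sup>2 * transfer_op a h y'"
proof -
  let ?I = "left_inverse a" and ?D = "left_branch_deriv a"
  have h0: "\<And>x. 0 \<le> h x"
    and mono: "\<And>x y. 0 < x \<Longrightarrow> x \<le> y \<Longrightarrow> y < 1 \<Longrightarrow> x\<^sup>2 * h x \<le> y\<^sup>2 * h y"
    using h by (auto simp: density_cone_def)
  have D: "0 < ?D x" for x using left_branch_deriv_ge_1[OF a(1), of x] by simp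
  define x x' z z' where defs: "x = ?I y" "x' = ?I y'" "z = ?I (1 - y)" "z' = ?I (1 - y')"
  have x: "0 < x" "x \<le> x'" "x' < 1/2"
    using y left_inverse_bounds[OF a(1)] monoD[OF left_inverse_mono[OF a(1)]] by (auto simp: defs)
  have z: "0 < z'" "z' \<le> z" "z < 1/2"
    using y left_inverse_bounds[OF a(1)] monoD[OF left_inverse_mono[OF a(1)]] by (auto simp: defs)
  have left: "y\<^sup>2 * (h x / ?D x) \<le> y'\<^sup>2 * (h x' / ?D x')"
  proof -
    have eq: "(left_branch a x)\<^sup>2 * (h x / ?D x) =
        (x\<^sup>2 * h x) * ((1 + (2 * x) powr a)\<^sup>2 / (1 + (1 + a) * (2 * x) powr a))" if "0 < x" for x
      using that by (simp add: left_branch_def left_branch_deriv_def power_mult_distrib)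
    have "(x\<^sup>2 * h x) * ((1 + (2 * x) powr a)\<^sup>2 / (1 + (1 + a) * (2 * x) powr a))
       \<le> (x'\<^sup>2 * h x') * ((1 + (2 * x') powr a)\<^sup>2 / (1 + (1 + a) * (2 * x') powr a))"
      using x a h0 by (intro mult_mono mono branch_ratio_mono powr_mono2)
        (auto intro!: divide_nonneg_nonneg add_nonneg_nonneg)
    then show ?thesis using eq[of x] eq[of x'] x a by (simp add: defs)
  qed
  have right: "y\<^sup>2 * (h (1 - z) / ?D z) \<le> y'\<^sup>2 * (h (1 - z') / ?D z')"
  proof -
    have yz: "y = 1 - left_branch a z" "y' = 1 - left_branch a z'"
      using a by (simp_all add: defs)
    \<comment> \<open>The quotient of the image \<open>y\<close> by its right preimage
      \<open>1 - z\<close> grows as \<open>z\<close> shrinks, since it equals 1 minus a product of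
      increasing functions of \<open>z\<close>. The slope at \<open>z\<close> shrinks as well, which
      helps further.\<close>
    have "(1 - left_branch a z) / (1 - z) \<le> (1 - left_branch a z') / (1 - z')"
    proof -
      have eq: "(1 - left_branch a w) / (1 - w) = 1 - w / (1 - w) * (2 * w) powr a"
        if "0 < w" "w < 1/2" for w
        using that by (simp add: left_branch_def field_simps)
      have "z' / (1 - z') * (2 * z') powr a \<le> z / (1 - z) * (2 * z) powr a"
        using z a by (intro mult_mono frac_le powr_mono2) auto
      then show ?thesis using eq[of z] eq[of z'] z by simp
    qed
    then have "y / (1 - z) \<le> y' / (1 - z')" by (simp add: yz)
    then have "(y / (1 - z))\<^sup>2 * ((1 - z)\<^sup>2 * h (1 - z)) / ?D z
        \<le> (y' / (1 - z'))\<^sup>2 * ((1 - z')\<^sup>2 * h (1 - z')) / ?D z'"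
      using y z a h0 D left_branch_deriv_mono[OF a(1) z(2)]
      by (intro frac_le[OF _ mult_mono[OF power_mono mono]]) auto
    then show ?thesis using z by (simp add: power_divide)
  qed
  show ?thesis
    using left right y unfolding transfer_op_def by (simp add: defs ring_distribs)
qed

lemma density_cone_transfer_op:
  assumes a: "0 < a" "a < 1" and h: "density_cone a h"
  shows "density_cone a (transfer_op a h)"
proof -
  have h': "h \<in> borel_measurable borel" "\<And>x. 0 \<le> h x" "\<And>x. x \<notin> {0<..<1} \<Longrightarrow> h x = 0"
    "(\<integral>\<^sup>+x. h x \<partial>lborel) = 1" and sym: "\<And>x. h (1 - x) = h x"
    using h by (auto simp: density_cone_def)
  note [measurable] = h'(1) borel_measurable_transfer_op[OF a(1) h'(1)]
  \<comment> \<open>Mass is conserved because the new density represents a pushforward.\<close>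
  have "(\<integral>\<^sup>+x. transfer_op a h x \<partial>lborel) = emeasure (density lborel (transfer_op a h)) UNIV"
    by (simp add: emeasure_density)
  also have "\<dots> = emeasure (density lborel h) UNIV"
    by (subst distr_intermittent_branch[OF a(1) h'(1-3), symmetric]) (auto simp: emeasure_distr)
  also have "\<dots> = 1" by (simp add: emeasure_density h')
  finally have "(\<integral>\<^sup>+x. transfer_op a h x \<partial>lborel) = 1" .
  moreover have "transfer_op a h (1 - y) = transfer_op a h y" for y
    using sym by (auto simp: transfer_op_def)
  ultimately show ?thesis
    unfolding density_cone_def[of a "transfer_op a h"]
    using transfer_op_mono[OF a h] transfer_op_bound[OF a h] transfer_op_nonneg[OF a(1) h'(2)]
    by (intro conjI allI impI) (simp_all add: a(1) h'(1), auto simp: transfer_op_def[of a h])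
qed

section \<open>An integrable majorant common to all parameters up to \<open>b\<close>\<close>

definition majorant :: "real \<Rightarrow> real \<Rightarrow> real" where
  "majorant b x = (if 0 < x \<and> x < 1 then 192 * (x powr (- b) + (1 - x) powr (- b)) else 0)"

lemma majorant_nonneg: "0 \<le> majorant b x"
  by (simp add: majorant_def)

lemma borel_measurable_majorant [measurable]: "majorant b \<in> borel_measurable borel"
  unfolding majorant_def[abs_def] by measurable

text \<open>Raising the exponent from \<open>a\<close> to \<open>b\<close> enlarges the bound since
  its argument is at most 1; symmetry transfers the bound to the right half.\<close>

lemma density_cone_le_majorant:
  assumes h: "density_cone a h" and ab: "0 < a" "a \<le> b"
  shows "h x \<le> majorant b x"
proof (cases "x \<in> {0<..<1}")
  case True
  have *: "h y \<le> 192 * y powr (- b)" if "0 < y" "y \<le> 1/2" for y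
  proof -
    have "h y \<le> 192 * y powr (- a)" using h that by (auto simp: density_cone_def)
    also have "y powr (- a) \<le> y powr (- b)" using that ab by (intro powr_mono') auto
    finally show ?thesis by simp
  qed
  have sym: "h (1 - x) = h x" using h by (auto simp: density_cone_def)
  have "h x \<le> 192 * x powr (- b) \<or> h x \<le> 192 * (1 - x) powr (- b)"
    using True *[of x] *[of "1 - x"] sym by (cases "x \<le> 1/2") auto
  moreover have "0 \<le> x powr (- b)" "0 \<le> (1 - x) powr (- b)" by auto
  moreover have "majorant b x = 192 * x powr (- b) + 192 * (1 - x) powr (- b)"
    using True by (simp add: majorant_def)
  ultimately show ?thesis by linarith
next
  case False
  then have "h x = 0" using h by (auto simp: density_cone_def)
  then show ?thesis by (simp add: majorant_nonneg)
qed

text \<open>The singularities at both ends are integrable because \<open>b < 1\<close>; each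
  contributes \<open>1 / (1 - b)\<close> before the factor 192.\<close>

lemma nn_integral_majorant_finite:
  assumes "b < 1"
  shows "(\<integral>\<^sup>+x. majorant b x \<partial>lborel) < \<infinity>"
proof -
  have I: "(\<integral>\<^sup>+x. ennreal (x powr (- b)) * indicator {0..1} x \<partial>lborel) = ennreal (1 / (1 - b))"
    using nn_integral_has_integral_lebesgue'[OF _ has_integral_powr_from_0[of "- b" 1]] assms
    by simp
  have J: "(\<integral>\<^sup>+x. ennreal ((1 - x) powr (- b)) * indicator {0..1} x \<partial>lborel) = ennreal (1 / (1 - b))"
    unfolding I[symmetric] by (subst (2) nn_integral_real_affine[where c="-1" and t=1])
      (auto intro!: nn_integral_cong split: split_indicator)
  have "(\<integral>\<^sup>+x. majorant b x \<partial>lborel) \<le> (\<integral>\<^sup>+x. ennreal 192 * (ennreal (x powr (- b)) * indicator {0..1} x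
      + ennreal ((1 - x) powr (- b)) * indicator {0..1} x) \<partial>lborel)"
    by (intro nn_integral_mono) (auto simp: majorant_def ennreal_mult ennreal_plus split: split_indicator)
  also have "\<dots> = ennreal 192 * (ennreal (1 / (1 - b)) + ennreal (1 / (1 - b)))"
    by (simp add: nn_integral_cmult nn_integral_add I J)
  also have "\<dots> < \<infinity>" by (simp add: ennreal_mult_less_top)
  finally show ?thesis .
qed

section \<open>Weak convergence under domination\<close>

text \<open>Truncated multiples of the distance to the complement approximate the indicator of an
  open set; outer regularity of \<open>N\<close> extends the inequality from open sets to Borel
  sets.\<close>

lemma measure_leI_continuous:
  fixes M N :: "'a::{second_countable_topology, complete_space} measure"
  assumes M: "sets M = sets borel" "finite_measure M" and N: "sets N = sets borel" "finite_measure N"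
    and le: "\<And>g :: 'a \<Rightarrow> real. continuous_on UNIV g \<Longrightarrow> (\<And>x. 0 \<le> g x \<and> g x \<le> 1) \<Longrightarrow>
      (\<integral>x. g x \<partial>M) \<le> (\<integral>x. g x \<partial>N)"
  shows "M \<le> N"
proof -
  interpret M: finite_measure M by fact
  interpret N: finite_measure N by fact
  have open_le: "emeasure M U \<le> emeasure N U" if U: "open U" for U :: "'a set"
  proof -
    \<comment> \<open>The whole space is treated apart, because \<open>infdist\<close> to the empty
      set is 0 by convention.\<close>
    define g where "g j x = (if U = UNIV then 1 else min 1 (real j * infdist x (- U)))" for j x
    have cont: "continuous_on UNIV (g j)" for j
      unfolding g_def by (cases "U = UNIV") (auto intro!: continuous_intros)
    have g01: "0 \<le> g j x \<and> g j x \<le> 1" for j x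
      by (simp add: g_def infdist_nonneg)
    have lim: "(\<lambda>j. g j x) \<longlonglongrightarrow> indicator U x" for x
    proof -
      consider "U = UNIV" | "x \<notin> U" | "U \<noteq> UNIV" "x \<in> U" by blast
      then show ?thesis
      proof cases
        case 1
        then show ?thesis by (simp add: g_def)
      next
        case 2
        then have "U \<noteq> UNIV" "infdist x (- U) = 0" by (auto simp: infdist_zero)
        then show ?thesis using 2 by (simp add: g_def)
      next
        case 3
        then have "infdist x (- U) \<noteq> 0"
          using U by (subst in_closed_iff_infdist_zero[symmetric]) auto
        then have pos: "0 < infdist x (- U)" using infdist_nonneg[of x "- U"] by linarith
        have "\<forall>\<^sub>F j in sequentially. g j x = 1"
        proof -
          obtain j0 :: nat where "1 / infdist x (- U) < real j0" using reals_Archimedean2 by blast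
          then have *: "1 < real j0 * infdist x (- U)" using pos by (simp add: divide_less_eq)
          show ?thesis
            using eventually_ge_at_top[of j0]
          proof eventually_elim
            case (elim j)
            then have "real j0 * infdist x (- U) \<le> real j * infdist x (- U)"
              using pos by (intro mult_right_mono) auto
            then show ?case using * by (auto simp: g_def)
          qed
        qed
        then show ?thesis using 3 by (simp add: tendsto_eventually)
      qed
    qed
    have conv: "(\<lambda>j. \<integral>x. g j x \<partial>K) \<longlonglongrightarrow> measure K U"
      if K: "sets K = sets borel" "finite_measure K" for K :: "'a measure"
    proof -
      interpret K: finite_measure K by fact
      have [measurable_cong]: "sets K = sets borel" by fact
      have [measurable]: "g j \<in> borel_measurable borel" for j
        using cont by (rule borel_measurable_continuous_onI)
      have [measurable]: "U \<in> sets borel" using U by simp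
      have "(\<lambda>j. \<integral>x. g j x \<partial>K) \<longlonglongrightarrow> (\<integral>x. indicator U x \<partial>K)"
        using g01 lim by (intro integral_dominated_convergence[where w="\<lambda>_. 1"]) auto
      then show ?thesis using sets_eq_imp_space_eq[OF K(1)] by simp
    qed
    have "measure M U \<le> measure N U"
      using le[OF cont g01] by (intro LIMSEQ_le[OF conv[OF M] conv[OF N]]) auto
    then show ?thesis by (simp add: M.emeasure_eq_measure N.emeasure_eq_measure)
  qed
  have "emeasure M A \<le> emeasure N A" if A: "A \<in> sets borel" for A
  proof -
    have "emeasure M A \<le> emeasure N U" if "A \<subseteq> U" "open U" for U
      using that M(1) by (intro order_trans[OF emeasure_mono open_le]) auto
    then have "emeasure M A \<le> (INF U\<in>{U. A \<subseteq> U \<and> open U}. emeasure N U)"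
      by (intro INF_greatest) auto
    also have "\<dots> = emeasure N A"
      using N A by (intro outer_regular[symmetric]) auto
    finally show ?thesis .
  qed
  then show ?thesis by (simp add: le_measure M N)
qed

text \<open>The bound and the finiteness of \<open>N\<close> make \<open>f\<close> integrable, so
  the right-hand integral is genuine and not the default value 0.\<close>

lemma integral_mono_measure_bounded:
  fixes f :: "'a \<Rightarrow> real"
  assumes MN: "M \<le> N" "sets M = sets N" and N: "finite_measure N"
    and [measurable]: "f \<in> borel_measurable N" and f: "\<And>x. 0 \<le> f x" "\<And>x. f x \<le> B"
  shows "(\<integral>x. f x \<partial>M) \<le> (\<integral>x. f x \<partial>N)"
proof -
  interpret N: finite_measure N by fact
  have M: "f \<in> borel_measurable M" using assms(4) measurable_cong_sets[OF MN(2) refl] by blast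
  have "(\<integral>\<^sup>+x. f x \<partial>M) \<le> (\<integral>\<^sup>+x. f x \<partial>N)"
    using MN by (intro nn_integral_mono_measure)
  also have "\<dots> = ennreal (\<integral>x. f x \<partial>N)"
    using f by (intro nn_integral_eq_integral N.integrable_const_bound[where B=B]) auto
  finally have "enn2real (\<integral>\<^sup>+x. f x \<partial>M) \<le> (\<integral>x. f x \<partial>N)"
    using f(1) by (intro enn2real_leI) (auto simp: enn2real_leI)
  then show ?thesis
    using M f(1) by (simp add: integral_eq_nn_integral)
qed

text \<open>Domination can be tested on continuous functions with values in \<open>[0, 1]\<close>,
  and their integrals pass to the weak limit.\<close>

lemma weak_conv_le:
  assumes m: "\<And>k. real_distribution (m k)" and M: "real_distribution M" and conv: "weak_conv_m m M"
    and N: "sets N = sets borel" "finite_measure N" and le: "\<And>k. m k \<le> N"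
  shows "M \<le> N"
proof (rule measure_leI_continuous)
  interpret M: real_distribution M by fact
  show "sets M = sets borel" "finite_measure M" by (simp, unfold_locales)
  fix g :: "real \<Rightarrow> real"
  assume g: "continuous_on UNIV g" "\<And>x. 0 \<le> g x \<and> g x \<le> 1"
  have "(\<lambda>k. \<integral>x. g x \<partial>m k) \<longlonglongrightarrow> (\<integral>x. g x \<partial>M)"
    using g by (intro weak_conv_imp_integral_bdd_continuous_conv[OF m M conv, where B=1])
      (auto simp: continuous_on_eq_continuous_at)
  moreover have "(\<integral>x. g x \<partial>m k) \<le> (\<integral>x. g x \<partial>N)" for k
  proof -
    interpret k: real_distribution "m k" by fact
    have [measurable_cong]: "sets N = sets borel" by fact
    have [measurable]: "g \<in> borel_measurable borel" using g(1) by (rule borel_measurable_continuous_onI)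
    show ?thesis using g N le by (intro integral_mono_measure_bounded[where B=1]) auto
  qed
  ultimately show "(\<integral>x. g x \<partial>M) \<le> (\<integral>x. g x \<partial>N)" by (intro LIMSEQ_le_const2) auto
qed (use N in auto)

text \<open>Measure and integrand vary together. Replacing \<open>u k\<close> by \<open>v\<close>
  costs at most the integral of their distance against the fixed \<open>N\<close>, which vanishes by
  dominated convergence. The fixed \<open>v\<close> is continuous \<open>M\<close>-almost everywhere
  because \<open>M \<le> N\<close>, so weak convergence handles it.\<close>

lemma weak_conv_dominated_integral:
  fixes u :: "nat \<Rightarrow> real \<Rightarrow> real"
  assumes m: "\<And>k. real_distribution (m k)" and M: "real_distribution M" and conv: "weak_conv_m m M"
    and N: "sets N = sets borel" "finite_measure N" and le: "\<And>k. m k \<le> N"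
    and [measurable]: "\<And>k. u k \<in> borel_measurable borel" "v \<in> borel_measurable borel"
    and u: "\<And>k x. \<bar>u k x\<bar> \<le> B" and v: "\<And>x. \<bar>v x\<bar> \<le> B"
    and lim: "AE x in N. (\<lambda>k. u k x) \<longlonglongrightarrow> v x" and cont: "AE x in N. isCont v x"
  shows "(\<lambda>k. \<integral>x. u k x \<partial>m k) \<longlonglongrightarrow> (\<integral>x. v x \<partial>M)"
proof -
  interpret N: finite_measure N by fact
  interpret m: real_distribution "m k" for k by fact
  interpret M: real_distribution M by fact
  have [measurable_cong]: "sets N = sets borel" by fact
  have MN: "M \<le> N" using m M conv N le by (rule weak_conv_le)
  have spN: "space N = UNIV" using sets_eq_imp_space_eq[OF N(1)] by simp
  have null: "emeasure M {x. \<not> isCont v x} = 0"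
  proof -
    obtain Z where Z: "{x. \<not> isCont v x} \<subseteq> Z" "emeasure N Z = 0" "Z \<in> sets N"
      using cont spN by (auto elim!: AE_E)
    have "emeasure M {x. \<not> isCont v x} \<le> emeasure M Z"
      using Z N by (intro emeasure_mono) auto
    also have "\<dots> \<le> emeasure N Z"
      using MN Z(3) le_measure[of M N] by (simp add: N)
    finally show ?thesis using Z by simp
  qed
  have 1: "(\<lambda>k. \<integral>x. v x \<partial>m k) \<longlonglongrightarrow> (\<integral>x. v x \<partial>M)"
    using v null by (intro weak_conv_imp_bdd_ae_continuous_conv[OF m M conv, where B=B]) auto
  have "(\<lambda>k. \<integral>x. \<bar>u k x - v x\<bar> \<partial>N) \<longlonglongrightarrow> (\<integral>x. 0 \<partial>N)"
  proof (rule integral_dominated_convergence[where w="\<lambda>_. 2 * B"])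
    show "AE x in N. (\<lambda>k. \<bar>u k x - v x\<bar>) \<longlonglongrightarrow> 0"
      using lim by eventually_elim (auto intro: tendsto_rabs_zero LIM_zero)
    show "AE x in N. norm \<bar>u k x - v x\<bar> \<le> 2 * B" for k
    proof (rule AE_I2)
      fix x show "norm \<bar>u k x - v x\<bar> \<le> 2 * B"
        using u[of k x] v[of x] by (simp add: abs_if split: if_splits)
    qed
  qed auto
  then have 2: "(\<lambda>k. \<integral>x. \<bar>u k x - v x\<bar> \<partial>N) \<longlonglongrightarrow> 0" by simp
  have "\<bar>(\<integral>x. u k x \<partial>m k) - (\<integral>x. v x \<partial>m k)\<bar> \<le> (\<integral>x. \<bar>u k x - v x\<bar> \<partial>N)" for k
  proof -
    have "integrable (m k) (u k)" "integrable (m k) v"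
      using u v by (auto intro!: m.integrable_const_bound[where B=B])
    then have "\<bar>(\<integral>x. u k x \<partial>m k) - (\<integral>x. v x \<partial>m k)\<bar> \<le> (\<integral>x. \<bar>u k x - v x\<bar> \<partial>m k)"
      using integral_abs_bound[of "m k" "\<lambda>x. u k x - v x"] by simp
    also have "\<dots> \<le> (\<integral>x. \<bar>u k x - v x\<bar> \<partial>N)"
    proof (rule integral_mono_measure_bounded[where B="2 * B"])
      fix x show "\<bar>u k x - v x\<bar> \<le> 2 * B" using u[of k x] v[of x] by linarith
    qed (use le N in auto)
    finally show ?thesis .
  qed
  then have "(\<lambda>k. (\<integral>x. u k x \<partial>m k) - (\<integral>x. v x \<partial>m k)) \<longlonglongrightarrow> 0"
    by (intro Lim_null_comparison[OF _ 2]) auto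
  from tendsto_add[OF this 1] show ?thesis by simp
qed

section \<open>Statistical stability of the circle map\<close>

text \<open>Joint continuity in parameter and point. The arbitrary filter covers both a sequence of
  parameters at a fixed point and, with constant \<open>A\<close>, continuity in the point.\<close>

lemma tendsto_intermittent_branch:
  fixes x :: real
  assumes A: "(A \<longlongrightarrow> a) F" and X: "(X \<longlongrightarrow> x) F" and x: "0 < x" "x < 1" "x \<noteq> 1/2"
  shows "((\<lambda>k. intermittent_branch (A k) (X k)) \<longlongrightarrow> intermittent_branch a x) F"
proof (cases "x < 1/2")
  case True
  have "((\<lambda>k. X k * (1 + 2 powr A k * X k powr A k)) \<longlongrightarrow> x * (1 + 2 powr a * x powr a)) F"
    using x by (intro tendsto_intros A X) auto
  moreover have "\<forall>\<^sub>F k in F. X k < 1/2" using X True by (rule order_tendstoD)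
  then have "\<forall>\<^sub>F k in F. X k * (1 + 2 powr A k * X k powr A k) = intermittent_branch (A k) (X k)"
    by eventually_elim (simp add: intermittent_branch_def)
  ultimately show ?thesis
    using True by (simp add: intermittent_branch_def[of a] tendsto_cong)
next
  case False
  have "((\<lambda>k. X k - 2 powr A k * (1 - X k) powr (A k + 1)) \<longlongrightarrow> x - 2 powr a * (1 - x) powr (a + 1)) F"
    using x by (intro tendsto_intros A X) auto
  moreover have "\<forall>\<^sub>F k in F. 1/2 < X k" using X False x by (intro order_tendstoD(1)[OF X]) auto
  then have "\<forall>\<^sub>F k in F. X k - 2 powr A k * (1 - X k) powr (A k + 1) = intermittent_branch (A k) (X k)"
    by eventually_elim (simp add: intermittent_branch_def)
  ultimately show ?thesis
    using False by (simp add: intermittent_branch_def[of a] tendsto_cong)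
qed

section \<open>Measurability of the passage between circle and interval\<close>

lemma borel_measurable_circle_of [measurable]: "circle_of \<in> borel_measurable borel"
  using continuous_on_circle_of by (rule borel_measurable_continuous_onI)

text \<open>The coordinate jumps only at the class of 0, where it takes its minimum. It is thus
  lower semicontinuous, and its strict superlevel sets are open.\<close>

lemma borel_measurable_circle_coord [measurable]: "circle_coord \<in> borel_measurable borel"
proof (rule borel_measurableI_greater)
  fix c :: real
  have "open {p. c < circle_coord p}"
  proof (cases "0 \<le> c")
    case True
    have "circle_of -` {p. c < circle_coord p} = (\<Union>n::int. {of_int n + c<..<of_int n + 1})"
    proof (intro set_eqI iffI)
      fix x assume "x \<in> circle_of -` {p. c < circle_coord p}"
      then have "c < frac x" by (simp add: circle_coord.abs_eq)
      then have "x \<in> {of_int \<lfloor>x\<rfloor> + c<..<of_int \<lfloor>x\<rfloor> + 1}"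
        unfolding frac_def by simp
      then show "x \<in> (\<Union>n::int. {of_int n + c<..<of_int n + 1})" by blast
    next
      fix x assume "x \<in> (\<Union>n::int. {of_int n + c<..<of_int n + 1})"
      then obtain n :: int where n: "of_int n + c < x" "x < of_int n + 1" by auto
      then have "\<lfloor>x\<rfloor> = n" using True by (intro floor_unique) auto
      then show "x \<in> circle_of -` {p. c < circle_coord p}"
        using n by (simp add: circle_coord.abs_eq frac_def)
    qed
    then show ?thesis by (simp add: open_circle_def open_UN)
  next
    case False
    then have "{p. c < circle_coord p} = UNIV" by (auto intro: less_le_trans[OF _ circle_coord_ge_0])
    then show ?thesis by simp
  qed
  then show "{p \<in> space borel. c < circle_coord p} \<in> sets borel" by simp
qed

lemma circle_coord_intermittent_map:
  "0 < a \<Longrightarrow> circle_coord (intermittent_map a p) = intermittent_branch a (circle_coord p)"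
  by (simp add: intermittent_map_def circle_coord_of intermittent_branch_range
      circle_coord_ge_0 circle_coord_less_1)

lemma borel_measurable_intermittent_map [measurable]: "intermittent_map a \<in> borel_measurable borel"
  unfolding intermittent_map_def[abs_def] by measurable

section \<open>Dominated measures and invariant measures on the circle\<close>

definition majorant_measure :: "real \<Rightarrow> real measure" where
  "majorant_measure b = density lborel (majorant b)"

lemma sets_majorant_measure [simp, measurable_cong]: "sets (majorant_measure b) = sets borel"
  by (simp add: majorant_measure_def)

lemma space_majorant_measure [simp]: "space (majorant_measure b) = UNIV"
  by (simp add: majorant_measure_def)

lemma finite_measure_majorant_measure:
  assumes "b < 1" shows "finite_measure (majorant_measure b)"
proof
  show "emeasure (majorant_measure b) (space (majorant_measure b)) \<noteq> \<infinity>"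
    using nn_integral_majorant_finite[OF assms] by (simp add: majorant_measure_def emeasure_density)
qed

text \<open>With \<open>Z = {}\<close> this only locates the mass in the open unit interval;
  nonempty \<open>Z\<close> collect the points where continuity may fail.\<close>

lemma AE_majorant_measure_finite:
  assumes "finite Z"
  shows "AE x in majorant_measure b. x \<in> {0<..<1} - Z"
proof -
  have "AE x in lborel. x \<notin> Z"
    using finite_imp_null_set_lborel[OF assms] by (rule AE_not_in)
  then show ?thesis
    unfolding majorant_measure_def
    by (subst AE_density) (auto simp: majorant_def elim!: eventually_mono split: if_splits)
qed

lemma AE_le_measure:
  assumes "M \<le> N" "sets M = sets N" "AE x in N. P x"
  shows "AE x in M. P x"
proof -
  obtain Z where Z: "{x \<in> space N. \<not> P x} \<subseteq> Z" "emeasure N Z = 0" "Z \<in> sets N"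
    using assms(3) by (rule AE_E)
  have "emeasure M Z \<le> emeasure N Z" using assms(1,2) Z(3) by (simp add: le_measure)
  with Z show ?thesis
    using assms(2) sets_eq_imp_space_eq[OF assms(2)] by (intro AE_I[of _ _ Z]) auto
qed

text \<open>Absolute continuity is inherited from the majorant, which has a Lebesgue density.
  Invariance passes to the circle because \<open>circle_of\<close> intertwines the two maps on the
  unit interval, which carries all the mass.\<close>

lemma acip_distr_circle_of:
  assumes M: "real_distribution M" and le: "M \<le> majorant_measure b" and a: "0 < a"
    and inv: "distr M borel (intermittent_branch a) = M"
  shows "acip a (distr M borel circle_of)"
proof -
  interpret M: real_distribution M by fact
  let ?\<nu> = "distr M borel circle_of"
  have unit: "AE x in M. x \<in> {0<..<1} - {}"
    by (rule AE_le_measure[OF le _ AE_majorant_measure_finite]) auto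
  have "prob_space ?\<nu>" by (intro M.prob_space_distr) simp
  moreover have "absolutely_continuous circle_lebesgue ?\<nu>"
    unfolding absolutely_continuous_def
  proof
    fix A assume A: "A \<in> null_sets circle_lebesgue"
    then have [measurable]: "A \<in> sets borel" by (auto simp: circle_lebesgue_def null_sets_def)
    have mA [measurable]: "circle_of -` A \<in> sets borel"
      using measurable_sets_borel[OF borel_measurable_circle_of] by simp
    have "emeasure lborel (circle_of -` A \<inter> {0..<1}) = 0"
    proof -
      have "emeasure circle_lebesgue A = emeasure (restrict_space lborel {0..<1}) (circle_of -` A \<inter> {0..<1})"
        unfolding circle_lebesgue_def
        by (subst emeasure_distr) (auto intro: measurable_restrict_space1 simp: space_restrict_space)
      also have "\<dots> = emeasure lborel (circle_of -` A \<inter> {0..<1})"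
        by (subst emeasure_restrict_space) auto
      finally show ?thesis using A by (simp add: null_sets_def)
    qed
    then have "circle_of -` A \<inter> {0..<1} \<in> null_sets lborel" by (simp add: null_sets_def)
    moreover have "absolutely_continuous lborel (majorant_measure b)"
      unfolding majorant_measure_def by (intro absolutely_continuousI_density) simp
    ultimately have "emeasure (majorant_measure b) (circle_of -` A \<inter> {0..<1}) = 0"
      by (auto simp: absolutely_continuous_def)
    moreover have "emeasure M (circle_of -` A \<inter> {0..<1}) \<le> emeasure (majorant_measure b) (circle_of -` A \<inter> {0..<1})"
      using le_measure[of M "majorant_measure b"] le by simp
    moreover have "emeasure M (circle_of -` A) = emeasure M (circle_of -` A \<inter> {0..<1})"
      using unit by (intro emeasure_eq_AE) auto
    ultimately have "emeasure ?\<nu> A = 0" by (simp add: emeasure_distr)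
    then show "A \<in> null_sets ?\<nu>" by (simp add: null_sets_def)
  qed
  moreover have "distr ?\<nu> ?\<nu> (intermittent_map a) = ?\<nu>"
  proof -
    have "distr ?\<nu> ?\<nu> (intermittent_map a) = distr M borel (intermittent_map a \<circ> circle_of)"
      by (subst distr_cong[OF refl sets_distr refl], subst distr_distr) auto
    also have "\<dots> = distr M borel (circle_of \<circ> intermittent_branch a)"
    proof (rule distr_cong_AE)
      show "AE x in M. (intermittent_map a \<circ> circle_of) x = (circle_of \<circ> intermittent_branch a) x"
        using unit by (rule eventually_mono) (simp add: intermittent_map_circle_of)
    qed auto
    also have "\<dots> = distr (distr M borel (intermittent_branch a)) borel circle_of"
      by (subst distr_distr) auto
    finally show ?thesis by (simp add: inv)
  qed
  ultimately show ?thesis by (simp add: acip_def invariant_measure_def)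
qed

lemma real_distribution_circle_coord:
  assumes "acip a \<nu>" shows "real_distribution (distr \<nu> borel circle_coord)"
proof -
  interpret prob_space \<nu> using assms by (simp add: acip_def)
  have [measurable_cong]: "sets \<nu> = sets borel" using assms by (simp add: acip_def)
  show ?thesis by (intro real_distribution.intro prob_space_distr real_distribution_axioms.intro) auto
qed

lemma acip_coord_integral:
  fixes g :: "real \<Rightarrow> real"
  assumes a: "0 < a" and \<nu>: "acip a \<nu>" and [measurable]: "g \<in> borel_measurable borel"
  shows "(\<integral>x. g (intermittent_branch a x) \<partial>distr \<nu> borel circle_coord) = (\<integral>x. g x \<partial>distr \<nu> borel circle_coord)"
proof -
  have [measurable_cong]: "sets \<nu> = sets borel" and inv: "distr \<nu> \<nu> (intermittent_map a) = \<nu>"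
    using \<nu> by (auto simp: acip_def invariant_measure_def)
  have "(\<integral>x. g (intermittent_branch a x) \<partial>distr \<nu> borel circle_coord) =
      (\<integral>p. g (circle_coord (intermittent_map a p)) \<partial>\<nu>)"
    by (simp add: integral_distr circle_coord_intermittent_map a)
  also have "\<dots> = (\<integral>p. g (circle_coord p) \<partial>distr \<nu> \<nu> (intermittent_map a))"
    by (subst integral_distr) auto
  finally show ?thesis by (simp add: inv integral_distr)
qed

text \<open>Only asymptotic invariance under the varying maps is assumed, so the lemma applies to
  Cesaro averages at a fixed parameter as well as to SRB measures along a sequence of parameters. By
  tightness it suffices to identify each subsequential limit.\<close>

lemma circle_stability:
  assumes a: "0 < a" and b: "b < 1" and SRB: "circle_SRB a \<nu>" and A: "A \<longlonglongrightarrow> a"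
    and m: "\<And>k. real_distribution (m k)" and le: "\<And>k. m k \<le> majorant_measure b"
    and asymp: "\<And>g :: real \<Rightarrow> real. continuous_on UNIV g \<Longrightarrow> (\<And>x. 0 \<le> g x \<and> g x \<le> 1) \<Longrightarrow>
      (\<lambda>k. (\<integral>x. g (intermittent_branch (A k) x) \<partial>m k) - (\<integral>x. g x \<partial>m k)) \<longlonglongrightarrow> 0"
  shows "weak_conv_m m (distr \<nu> borel circle_coord)"
proof (rule tight_subseq_weak_converge)
  have \<nu>: "acip a \<nu>" using SRB by (simp add: circle_SRB_def)
  then show "real_distribution (distr \<nu> borel circle_coord)" by (rule real_distribution_circle_coord)
  note fin = finite_measure_majorant_measure[OF b]
  show "tight m"
  proof -
    \<comment> \<open>All the mass lies in \<open>(0, 1)\<close>, so one half-open interval of the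
      shape required by \<open>tight\<close> serves every \<open>k\<close>.\<close>
    have "measure (m k) {-1<..1} = 1" for k
    proof -
      interpret k: real_distribution "m k" by fact
      have "AE x in m k. x \<in> {0<..<1} - {}"
        by (rule AE_le_measure[OF le _ AE_majorant_measure_finite]) auto
      then have "AE x in m k. x \<in> {-1<..1}" by (rule eventually_mono) auto
      then show ?thesis by (intro k.prob_eq_1[THEN iffD2]) auto
    qed
    then show ?thesis using m unfolding tight_def by (intro conjI allI impI exI[of _ "-1"] exI[of _ 1]) auto
  qed
  fix s :: "nat \<Rightarrow> nat" and M
  assume s: "strict_mono s" and M: "real_distribution M" and conv: "weak_conv_m (m \<circ> s) M"
  interpret M: real_distribution M by fact
  have ms: "real_distribution ((m \<circ> s) k)" "(m \<circ> s) k \<le> majorant_measure b" for k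
    using m le by auto
  have Mle: "M \<le> majorant_measure b"
    using ms(1) M conv sets_majorant_measure fin ms(2) by (rule weak_conv_le)
  have eq: "(\<integral>x. g (intermittent_branch a x) \<partial>M) = (\<integral>x. g x \<partial>M)"
    if g: "continuous_on UNIV g" "\<And>x. 0 \<le> g x \<and> g x \<le> 1" for g :: "real \<Rightarrow> real"
  proof -
    have [measurable]: "g \<in> borel_measurable borel" using g(1) by (rule borel_measurable_continuous_onI)
    have gc: "isCont g y" for y using g(1) by (simp add: continuous_on_eq_continuous_at)
    have g1: "\<bar>g x\<bar> \<le> 1" for x using g(2)[of x] by auto
    have As: "(\<lambda>k. A (s k)) \<longlonglongrightarrow> a" using LIMSEQ_subseq_LIMSEQ[OF A s] by (simp add: o_def)
    have "(\<lambda>k. \<integral>x. g (intermittent_branch (A (s k)) x) \<partial>(m \<circ> s) k) \<longlonglongrightarrow> (\<integral>x. g (intermittent_branch a x) \<partial>M)"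
    proof (rule weak_conv_dominated_integral[OF ms(1) M conv sets_majorant_measure fin ms(2)])
      show "AE x in majorant_measure b. (\<lambda>k. g (intermittent_branch (A (s k)) x)) \<longlonglongrightarrow> g (intermittent_branch a x)"
        by (rule eventually_mono[OF AE_majorant_measure_finite[of "{1/2}"]])
          (auto intro!: isCont_tendsto_compose[OF gc] tendsto_intermittent_branch As)
      show "AE x in majorant_measure b. isCont (\<lambda>x. g (intermittent_branch a x)) x"
        by (rule eventually_mono[OF AE_majorant_measure_finite[of "{1/2}"]])
          (auto simp: isCont_def intro!: isCont_tendsto_compose[OF gc] tendsto_intermittent_branch)
    qed (use g1 in auto)
    moreover have "(\<lambda>k. \<integral>x. g x \<partial>(m \<circ> s) k) \<longlonglongrightarrow> (\<integral>x. g x \<partial>M)"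
      using gc g1 by (intro weak_conv_imp_integral_bdd_continuous_conv[OF ms(1) M conv, where B=1]) auto
    ultimately have "(\<lambda>k. (\<integral>x. g (intermittent_branch (A (s k)) x) \<partial>(m \<circ> s) k) - (\<integral>x. g x \<partial>(m \<circ> s) k))
        \<longlonglongrightarrow> (\<integral>x. g (intermittent_branch a x) \<partial>M) - (\<integral>x. g x \<partial>M)"
      by (rule tendsto_diff)
    moreover have "(\<lambda>k. (\<integral>x. g (intermittent_branch (A (s k)) x) \<partial>(m \<circ> s) k) - (\<integral>x. g x \<partial>(m \<circ> s) k)) \<longlonglongrightarrow> 0"
      using LIMSEQ_subseq_LIMSEQ[OF asymp[OF g] s] by (simp add: o_def)
    ultimately show ?thesis using LIMSEQ_unique by fastforce
  qed
  have inv: "distr M borel (intermittent_branch a) = M"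
  proof -
    have *: "(\<integral>x. g x \<partial>distr M borel (intermittent_branch a)) = (\<integral>x. g x \<partial>M)"
      if "continuous_on UNIV g" "\<And>x. 0 \<le> g x \<and> g x \<le> 1" for g :: "real \<Rightarrow> real"
      using that eq[OF that] by (subst integral_distr) (auto intro: borel_measurable_continuous_onI)
    have fin: "finite_measure (distr M borel (intermittent_branch a))" "finite_measure M"
      by (rule M.finite_measure_distr, simp) unfold_locales
    \<comment> \<open>Equal integrals of test functions give the inequality between the measures in
      both directions.\<close>
    show ?thesis
      using fin * by (intro antisym measure_leI_continuous) auto
  qed
  have unit: "AE x in M. x \<in> {0<..<1} - {}"
    by (rule AE_le_measure[OF Mle _ AE_majorant_measure_finite]) auto
  \<comment> \<open>Uniqueness of the acip determines the limit on the circle;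
    \<open>circle_coord\<close> then recovers \<open>M\<close>, as it undoes
    \<open>circle_of\<close> on the unit interval.\<close>
  have "distr M borel circle_of = \<nu>"
    using SRB acip_distr_circle_of[OF M Mle a inv] by (simp add: circle_SRB_def)
  then have "distr \<nu> borel circle_coord = distr (distr M borel circle_of) borel circle_coord" by simp
  also have "\<dots> = distr M borel (circle_coord \<circ> circle_of)" by (subst distr_distr) auto
  also have "\<dots> = distr M borel (\<lambda>x. x)"
  proof (rule distr_cong_AE)
    show "AE x in M. (circle_coord \<circ> circle_of) x = x"
      using unit by (rule eventually_mono) (simp add: circle_coord_of)
  qed auto
  also have "\<dots> = M" by (intro distr_id2) simp
  finally show "weak_conv_m (m \<circ> s) (distr \<nu> borel circle_coord)" using conv by simp
qed (use m in auto)

section \<open>The SRB measures lie below the majorant\<close>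

lemma density_cone_iterate:
  assumes "0 < a" "a < 1"
  shows "density_cone a ((transfer_op a ^^ j) (indicator {0<..<1}))"
  by (induction j) (simp_all add: assms density_cone_indicator density_cone_transfer_op)

text \<open>The Cesaro averages of the iterates of Lebesgue measure are asymptotically invariant,
  so they converge to the unique acip, which inherits the bound on their densities.\<close>

lemma acip_le_majorant:
  assumes a: "0 < a" "a \<le> b" and b: "b < 1" and SRB: "circle_SRB a \<nu>"
  shows "distr \<nu> borel circle_coord \<le> majorant_measure b"
proof -
  have a1: "a < 1" using a b by simp
  define h where "h j = (transfer_op a ^^ j) (indicator {0<..<1})" for j
  have hcone: "density_cone a (h j)" for j
    unfolding h_def by (rule density_cone_iterate[OF a(1) a1])
  have h_meas [measurable]: "h j \<in> borel_measurable borel" and h0: "0 \<le> h j x"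
    and h_out: "x \<notin> {0<..<1} \<Longrightarrow> h j x = 0" and h1: "(\<integral>\<^sup>+x. h j x \<partial>lborel) = 1" for j x
    using hcone[of j] by (auto simp: density_cone_def)
  have h_le: "h j x \<le> majorant b x" for j x
    by (rule density_cone_le_majorant[OF hcone a])
  have step: "distr (density lborel (h j)) borel (intermittent_branch a) = density lborel (h (Suc j))" for j
    using distr_intermittent_branch[OF a(1) h_meas h0 h_out, of j] by (simp add: h_def)
  \<comment> \<open>The average runs over the \<open>k + 1\<close> indices from 0 to
    \<open>k\<close>, so the denominator is positive even for \<open>k = 0\<close>.\<close>
  define c where "c k x = (\<Sum>j\<le>k. h j x) / (real k + 1)" for k x
  define m where "m k = density lborel (c k)" for k
  have c_meas [measurable]: "c k \<in> borel_measurable borel" for k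
    unfolding c_def[abs_def] by measurable
  have c0: "0 \<le> c k x" for k x by (auto simp: c_def intro!: divide_nonneg_nonneg sum_nonneg h0)
  have c_le: "c k x \<le> majorant b x" for k x
  proof -
    have "(\<Sum>j\<le>k. h j x) \<le> (\<Sum>j\<le>k. majorant b x)" by (intro sum_mono h_le)
    then show ?thesis by (simp add: c_def divide_le_eq mult.commute add.commute)
  qed
  have c1: "(\<integral>\<^sup>+x. c k x \<partial>lborel) = 1" for k
  proof -
    have "(\<integral>\<^sup>+x. c k x \<partial>lborel) = (\<integral>\<^sup>+x. ennreal (1 / (real k + 1)) * (\<Sum>j\<le>k. ennreal (h j x)) \<partial>lborel)"
      by (intro nn_integral_cong) (simp add: c_def sum_ennreal h0 sum_nonneg flip: ennreal_mult)
    also have "\<dots> = ennreal (1 / (real k + 1)) * (\<Sum>j\<le>k. (\<integral>\<^sup>+x. h j x \<partial>lborel))"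
      by (simp add: nn_integral_cmult nn_integral_sum)
    also have "\<dots> = ennreal (1 / (real k + 1)) * ennreal (real k + 1)"
      by (simp add: h1 ennreal_plus ennreal_of_nat_eq_real_of_nat add.commute)
    also have "\<dots> = 1" by (subst ennreal_mult[symmetric]) auto
    finally show ?thesis .
  qed
  have m: "real_distribution (m k)" for k
  proof -
    have "prob_space (m k)" by (rule prob_spaceI) (simp add: m_def emeasure_density c1)
    then show ?thesis by (intro real_distribution.intro real_distribution_axioms.intro) (auto simp: m_def)
  qed
  have m_le: "m k \<le> majorant_measure b" for k
    using c_le by (subst le_measure) (auto simp: m_def majorant_measure_def emeasure_density
        intro!: nn_integral_mono mult_right_mono ennreal_leI)
  have integral_m: "(\<integral>x. g x \<partial>m k) = (\<Sum>j\<le>k. (\<integral>x. g x \<partial>density lborel (h j))) / (real k + 1)"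
    if [measurable]: "g \<in> borel_measurable borel" and g: "\<And>x. 0 \<le> g x \<and> g x \<le> 1" for g k
  proof -
    have int: "integrable lborel (\<lambda>x. h j x * g x)" for j
    proof (rule Bochner_Integration.integrable_bound)
      show "integrable lborel (h j)"
        using h1[of j] h0 by (intro integrableI_nonneg) auto
      show "AE x in lborel. norm (h j x * g x) \<le> norm (h j x)"
        using g h0 by (intro AE_I2) (auto simp: abs_mult mult_left_le)
    qed auto
    have "(\<integral>x. g x \<partial>m k) = (\<integral>x. (\<Sum>j\<le>k. h j x * g x) / (real k + 1) \<partial>lborel)"
      unfolding m_def using c0 by (subst integral_density) (auto simp: c_def sum_distrib_right)
    also have "\<dots> = (\<Sum>j\<le>k. (\<integral>x. h j x * g x \<partial>lborel)) / (real k + 1)"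
      using int by simp
    also have "(\<Sum>j\<le>k. (\<integral>x. h j x * g x \<partial>lborel)) = (\<Sum>j\<le>k. (\<integral>x. g x \<partial>density lborel (h j)))"
      using h0 by (intro sum.cong refl) (subst integral_density, auto)
    finally show ?thesis .
  qed
  have "weak_conv_m m (distr \<nu> borel circle_coord)"
  proof (rule circle_stability[OF a(1) b SRB tendsto_const m m_le])
    fix g :: "real \<Rightarrow> real"
    assume "continuous_on UNIV g" and g: "\<And>x. 0 \<le> g x \<and> g x \<le> 1"
    then have [measurable]: "g \<in> borel_measurable borel" by (intro borel_measurable_continuous_onI)
    define I where "I j = (\<integral>x. g x \<partial>density lborel (h j))" for j
    have I01: "0 \<le> I j \<and> I j \<le> 1" for j
    proof -
      have p: "prob_space (density lborel (h j))"
        by (rule prob_spaceI) (simp add: emeasure_density h1)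
      then interpret prob_space "density lborel (h j)" .
      have "I j \<le> 1" unfolding I_def using g by (intro integral_le_const integrable_const_bound[where B=1]) auto
      then show ?thesis using g by (simp add: I_def)
    qed
    have gT: "(\<integral>x. g (intermittent_branch a x) \<partial>density lborel (h j)) = I (Suc j)" for j
      unfolding I_def step[symmetric] by (subst integral_distr) auto
    \<comment> \<open>Applying the map shifts the index by one, so the sum telescopes to two terms
      in \<open>[0, 1]\<close> and the defect is at most \<open>1 / (k + 1)\<close>.\<close>
    have "(\<integral>x. g (intermittent_branch a x) \<partial>m k) - (\<integral>x. g x \<partial>m k) = (I (Suc k) - I 0) / (real k + 1)" for k
    proof -
      have "(\<integral>x. g (intermittent_branch a x) \<partial>m k) - (\<integral>x. g x \<partial>m k)
          = ((\<Sum>j\<le>k. I (Suc j)) - (\<Sum>j\<le>k. I j)) / (real k + 1)"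
        using g by (simp add: integral_m gT diff_divide_distrib flip: I_def)
      also have "(\<Sum>j\<le>k. I (Suc j)) - (\<Sum>j\<le>k. I j) = I (Suc k) - I 0"
        by (induction k) auto
      finally show ?thesis .
    qed
    moreover have "(\<lambda>k. (I (Suc k) - I 0) / (real k + 1)) \<longlonglongrightarrow> 0"
    proof (rule Lim_null_comparison)
      show "\<forall>\<^sub>F k in sequentially. norm ((I (Suc k) - I 0) / (real k + 1)) \<le> inverse (real (Suc k))"
      proof (intro always_eventually allI)
        fix k
        have "\<bar>I (Suc k) - I 0\<bar> \<le> 1" using I01[of "Suc k"] I01[of 0] by auto
        then have "\<bar>I (Suc k) - I 0\<bar> / (real k + 1) \<le> 1 / (real k + 1)" by (intro divide_right_mono) auto
        then show "norm ((I (Suc k) - I 0) / (real k + 1)) \<le> inverse (real (Suc k))"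
          by (simp add: inverse_eq_divide add.commute)
      qed
      show "(\<lambda>k. inverse (real (Suc k))) \<longlonglongrightarrow> 0" by (rule LIMSEQ_inverse_real_of_nat)
    qed
    ultimately show "(\<lambda>k. (\<integral>x. g (intermittent_branch a x) \<partial>m k) - (\<integral>x. g x \<partial>m k)) \<longlonglongrightarrow> 0" by simp
  qed
  moreover have "real_distribution (distr \<nu> borel circle_coord)"
    using SRB by (auto simp: circle_SRB_def intro: real_distribution_circle_coord)
  \<comment> \<open>The averages lie below the majorant, and this persists in their weak
    limit.\<close>
  ultimately show ?thesis
    using weak_conv_le[of m, OF m _ _ sets_majorant_measure finite_measure_majorant_measure[OF b] m_le] by blast
qed

section \<open>The solenoid\<close>

text \<open>Taking the base coordinate in the real line puts limits and measurability into a
  Euclidean space; \<open>solenoid_chart\<close> leads back to the torus.\<close>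

definition solenoid_lift :: "real \<Rightarrow> real \<times> real \<times> real \<Rightarrow> real \<times> real \<times> real" where
  "solenoid_lift a p = (intermittent_branch a (fst p),
     1/2 * cos (2 * pi * fst p) + 1/5 * fst (snd p),
     1/2 * sin (2 * pi * fst p) + 1/5 * snd (snd p))"

definition solenoid_chart :: "real \<times> real \<times> real \<Rightarrow> circle \<times> real \<times> real" where
  "solenoid_chart p = (circle_of (fst p), snd p)"

lemma continuous_on_solenoid_chart: "continuous_on S solenoid_chart"
  unfolding solenoid_chart_def[abs_def]
  by (intro continuous_on_Pair continuous_on_compose2[OF continuous_on_circle_of] continuous_intros) auto

lemma solenoid_chart_in_solid_torus: "solenoid_chart p \<in> solid_torus \<longleftrightarrow> p \<in> UNIV \<times> cball 0 1"
  by (cases p) (auto simp: solenoid_chart_def mem_solid_torus)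

lemma fst_solenoid_lift_iterate: "fst ((solenoid_lift a ^^ m) p) = (intermittent_branch a ^^ m) (fst p)"
  by (induction m) (auto simp: solenoid_lift_def)

lemma solenoid_map_chart:
  assumes "fst p \<in> {0..<1}"
  shows "solenoid_map a (solenoid_chart p) = solenoid_chart (solenoid_lift a p)"
  using assms by (cases p) (auto simp: solenoid_chart_def solenoid_lift_def intermittent_map_circle_of circle_coord_of)

lemma intermittent_branch_iterate_range:
  assumes "0 < a" "x \<in> {0..<1}"
  shows "(intermittent_branch a ^^ m) x \<in> {0..<1}"
  using assms by (induction m) (auto simp: intermittent_branch_range)

lemma solenoid_map_chart_iterate:
  assumes "0 < a" "fst p \<in> {0..<1}"
  shows "(solenoid_map a ^^ m) (solenoid_chart p) = solenoid_chart ((solenoid_lift a ^^ m) p)"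
proof (induction m)
  case (Suc m)
  have "fst ((solenoid_lift a ^^ m) p) \<in> {0..<1}"
    unfolding fst_solenoid_lift_iterate by (rule intermittent_branch_iterate_range[OF assms])
  then show ?case by (simp add: Suc.IH solenoid_map_chart)
qed simp

text \<open>Inherited from \<open>solenoid_map_in_solid_torus\<close>: the coordinate
  \<open>frac t\<close> differs from \<open>t\<close> by an integer, which sine and cosine of
  \<open>2 * pi * t\<close> do not see.\<close>

lemma solenoid_lift_in_disk:
  assumes "p \<in> UNIV \<times> cball 0 1"
  shows "solenoid_lift a p \<in> UNIV \<times> cball 0 1"
proof -
  obtain t y z where tyz: "p = (t, y, z)" by (cases p) auto
  have "solenoid_map a (circle_of t, y, z) \<in> solid_torus"
    using assms tyz by (intro solenoid_map_in_solid_torus) (simp add: mem_solid_torus)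
  moreover have "cos (2 * pi * frac t) = cos (2 * pi * t)" "sin (2 * pi * frac t) = sin (2 * pi * t)"
    by (simp_all add: frac_def right_diff_distrib cos_diff sin_diff)
  ultimately show ?thesis
    by (simp add: tyz solenoid_lift_def mem_solid_torus circle_coord.abs_eq)
qed

lemma solenoid_lift_iterate_in_disk:
  "p \<in> UNIV \<times> cball 0 1 \<Longrightarrow> (solenoid_lift a ^^ m) p \<in> UNIV \<times> cball 0 1"
proof (induction m)
  case (Suc m)
  then show ?case using solenoid_lift_in_disk[of "(solenoid_lift a ^^ m) p" a] by (simp only: funpow.simps comp_def)
qed simp

lemma solenoid_map_iterate_in_solid_torus:
  assumes "p \<in> solid_torus" shows "(solenoid_map a ^^ m) p \<in> solid_torus"
  by (induction m) (simp_all add: assms solenoid_map_in_solid_torus del: solenoid_map.simps)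

text \<open>The base orbit ignores the fibre coordinate, so the trigonometric terms cancel in the
  difference and only the linear contraction remains.\<close>

lemma solenoid_map_iterate_fibre:
  "fst ((solenoid_map a ^^ m) (x, v)) = fst ((solenoid_map a ^^ m) (x, w)) \<and>
   snd ((solenoid_map a ^^ m) (x, v)) - snd ((solenoid_map a ^^ m) (x, w)) = (1/5) ^ m *\<^sub>R (v - w)"
proof (induction m)
  case (Suc m)
  obtain s y z where 1: "(solenoid_map a ^^ m) (x, v) = (s, y, z)" by (cases "(solenoid_map a ^^ m) (x, v)") auto
  obtain s' y' z' where 2: "(solenoid_map a ^^ m) (x, w) = (s', y', z')" by (cases "(solenoid_map a ^^ m) (x, w)") auto
  have "s' = s" "(y, z) - (y', z') = (1/5) ^ m *\<^sub>R (v - w)" using Suc 1 2 by auto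
  moreover have "snd (solenoid_map a (s, y, z)) - snd (solenoid_map a (s, y', z')) = (1/5) *\<^sub>R ((y, z) - (y', z'))"
    by simp
  ultimately show ?case using 1 2 by (simp del: diff_Pair)
qed simp

text \<open>The induction removes the first application of the lift, not the last, hence the
  generalization over \<open>P\<close> and \<open>p\<close>. Avoiding \<open>1/2\<close> keeps each
  successive base point in the open interval of continuity.\<close>

lemma tendsto_solenoid_lift_iterate:
  assumes A: "(A \<longlongrightarrow> a) F" and a: "0 < a" and P: "(P \<longlongrightarrow> p) F" and p: "fst p \<in> {0<..<1}"
    and reg: "\<And>j. j < m \<Longrightarrow> (intermittent_branch a ^^ j) (fst p) \<noteq> 1/2"
  shows "((\<lambda>k. (solenoid_lift (A k) ^^ m) (P k)) \<longlongrightarrow> (solenoid_lift a ^^ m) p) F"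
  using P p reg
proof (induction m arbitrary: P p)
  case (Suc m)
  have half: "fst p \<noteq> 1/2" using Suc.prems(3)[of 0] by simp
  have angle: "((\<lambda>k. 2 * pi * fst (P k)) \<longlongrightarrow> 2 * pi * fst p) F"
    using Suc.prems(1) by (intro tendsto_intros)
  have "((\<lambda>k. solenoid_lift (A k) (P k)) \<longlongrightarrow> solenoid_lift a p) F"
    unfolding solenoid_lift_def using Suc.prems(2) half
    by (intro tendsto_Pair isCont_tendsto_compose[OF isCont_cos angle]
        isCont_tendsto_compose[OF isCont_sin angle] tendsto_intermittent_branch
        A Suc.prems(1) tendsto_intros) auto
  moreover have "fst (solenoid_lift a p) \<in> {0<..<1}"
    using Suc.prems(2) half a by (simp add: solenoid_lift_def intermittent_branch_pos intermittent_branch_range)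
  moreover have "(intermittent_branch a ^^ j) (fst (solenoid_lift a p)) \<noteq> 1/2" if "j < m" for j
    using Suc.prems(3)[of "Suc j"] that by (simp add: solenoid_lift_def funpow_Suc_right del: funpow.simps)
  ultimately show ?case
    unfolding funpow_Suc_right comp_def by (rule Suc.IH)
qed auto

text \<open>Each branch is injective, so every step backwards at most doubles the number of
  points.\<close>

lemma finite_intermittent_branch_preimage:
  assumes a: "0 < a"
  shows "finite Z \<Longrightarrow> finite {x \<in> {0..<1}. (intermittent_branch a ^^ j) x \<in> Z}"
proof (induction j arbitrary: Z)
  case 0
  then show ?case by simp
next
  case (Suc j)
  let ?Y = "{x \<in> {0..<1}. (intermittent_branch a ^^ j) x \<in> Z}"
  have "{x \<in> {0..<1}. (intermittent_branch a ^^ Suc j) x \<in> Z} \<subseteq>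
      left_inverse a ` ?Y \<union> (\<lambda>y. 1 - left_inverse a (1 - y)) ` ?Y"
  proof
    fix x assume x: "x \<in> {x \<in> {0..<1}. (intermittent_branch a ^^ Suc j) x \<in> Z}"
    then have Y: "intermittent_branch a x \<in> ?Y"
      using a by (simp add: funpow_Suc_right intermittent_branch_range del: funpow.simps)
    show "x \<in> left_inverse a ` ?Y \<union> (\<lambda>y. 1 - left_inverse a (1 - y)) ` ?Y"
    proof (cases "x < 1/2")
      case True
      then have "x = left_inverse a (intermittent_branch a x)" using x a by (simp add: intermittent_branch_left)
      then show ?thesis using Y by blast
    next
      case False
      then have "x = 1 - left_inverse a (1 - intermittent_branch a x)"
        using x a by (simp add: intermittent_branch_right)
      then show ?thesis using Y by blast
    qed
  qed
  then show ?case using Suc.IH[OF Suc.prems] by (auto intro: finite_subset)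
qed

section \<open>Compactness and uniform continuity along fibres\<close>

lemma compact_solid_torus: "compact solid_torus"
proof -
  have "UNIV = circle_of ` {0..1}"
    using circle_of_coord circle_coord_ge_0 circle_coord_less_1
    by (metis atLeastAtMost_iff less_imp_le rev_image_eqI UNIV_I subsetI subset_antisym top_greatest)
  then have "compact (UNIV :: circle set)"
    by (metis compact_Icc compact_continuous_image continuous_on_circle_of continuous_on_subset subset_UNIV)
  then show ?thesis unfolding solid_torus_def by (intro compact_Times) auto
qed

text \<open>The type \<open>circle\<close> carries only a topology; pulling back along the chart to
  a compact Euclidean set makes uniform continuity available.\<close>

lemma uniform_fibre_continuity:
  assumes \<phi>: "continuous_on solid_torus \<phi>" and e: "0 < (e::real)"
  obtains d where "0 < d"
    "\<And>x v w. norm v \<le> 1 \<Longrightarrow> norm w \<le> 1 \<Longrightarrow> dist v w < d \<Longrightarrow> \<bar>\<phi> (x, v) - \<phi> (x, w) :: real\<bar> < e"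
proof -
  let ?K = "{0..1} \<times> cball (0 :: real \<times> real) 1"
  have "continuous_on ?K (\<lambda>p. \<phi> (solenoid_chart p))"
    by (rule continuous_on_compose2[OF \<phi> continuous_on_solenoid_chart])
      (auto simp: solenoid_chart_in_solid_torus)
  then have "uniformly_continuous_on ?K (\<lambda>p. \<phi> (solenoid_chart p))"
    by (intro compact_uniformly_continuous compact_Times) auto
  then obtain d where d: "0 < d" "\<And>p q. p \<in> ?K \<Longrightarrow> q \<in> ?K \<Longrightarrow> dist q p < d \<Longrightarrow>
      dist (\<phi> (solenoid_chart q)) (\<phi> (solenoid_chart p)) < e"
    using e unfolding uniformly_continuous_on_def by metis
  have "\<bar>\<phi> (x, v) - \<phi> (x, w)\<bar> < e" if "norm v \<le> 1" "norm w \<le> 1" "dist v w < d" for x v w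
    using d(2)[of "(circle_coord x, w)" "(circle_coord x, v)"] that circle_coord_ge_0[of x] circle_coord_less_1[of x]
    by (simp add: solenoid_chart_def circle_of_coord dist_Pair_Pair dist_real_def)
  with d(1) show ?thesis by (rule that)
qed

lemma invariant_integral_iterate:
  fixes f :: "'a \<Rightarrow> real"
  assumes inv: "invariant_measure T M" and f: "f \<in> borel_measurable M"
  shows "(\<lambda>x. f ((T ^^ m) x)) \<in> borel_measurable M \<and> (\<integral>x. f ((T ^^ m) x) \<partial>M) = (\<integral>x. f x \<partial>M)"
proof (induction m)
  case (Suc m)
  have T: "T \<in> measurable M M" "distr M M T = M" using inv by (auto simp: invariant_measure_def)
  have "(\<lambda>x. f ((T ^^ m) (T x))) \<in> borel_measurable M"
    using Suc T(1) by (auto intro: measurable_compose[OF T(1)])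
  moreover have "(\<integral>x. f ((T ^^ m) (T x)) \<partial>M) = (\<integral>x. f ((T ^^ m) x) \<partial>distr M M T)"
    using Suc T(1) by (subst integral_distr) auto
  ultimately show ?case using Suc T(2) by (simp add: funpow_Suc_right del: funpow.simps)
qed (use f in simp)

section \<open>Reduction of observables to the base\<close>

definition central_observable ::
    "(circle \<times> real \<times> real \<Rightarrow> real) \<Rightarrow> real \<Rightarrow> nat \<Rightarrow> real \<Rightarrow> real" where
  "central_observable \<phi> a m t = \<phi> (solenoid_chart ((solenoid_lift a ^^ m) (t, 0)))"

lemma central_observable_in_disk: "(solenoid_lift a ^^ m) (t, 0) \<in> UNIV \<times> cball 0 1"
  by (intro solenoid_lift_iterate_in_disk) auto

lemma continuous_on_chart_observable:
  assumes "continuous_on solid_torus \<phi>"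
  shows "continuous_on (UNIV \<times> cball 0 1) (\<lambda>p. \<phi> (solenoid_chart p))"
  by (rule continuous_on_compose2[OF assms continuous_on_solenoid_chart])
    (auto simp: solenoid_chart_in_solid_torus)

lemma borel_measurable_solenoid_lift_iterate [measurable]:
  "solenoid_lift a ^^ m \<in> borel_measurable borel"
proof (induction m)
  case (Suc m)
  have "solenoid_lift a \<in> borel_measurable borel"
    unfolding solenoid_lift_def[abs_def] borel_prod[symmetric] by measurable
  then show ?case using Suc by (simp add: measurable_comp)
qed (simp add: id_def)

lemma borel_measurable_central_observable [measurable]:
  assumes \<phi>: "continuous_on solid_torus \<phi>"
  shows "central_observable \<phi> a m \<in> borel_measurable borel"
proof -
  let ?D = "UNIV \<times> cball 0 1 :: (real \<times> real \<times> real) set"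
  \<comment> \<open>Continuity of \<open>\<phi>\<close> is known on the torus only, so the function
    is cut off outside the closed set \<open>?D\<close>; the orbit of the centre never leaves it,
    and the cutoff disappears.\<close>
  have "(\<lambda>p. indicator ?D p *\<^sub>R \<phi> (solenoid_chart p)) \<in> borel_measurable borel"
    using continuous_on_chart_observable[OF \<phi>]
    by (intro borel_measurable_continuous_on_indicator) (auto intro!: borel_closed closed_Times)
  moreover have "(\<lambda>t. (solenoid_lift a ^^ m) (t, 0)) \<in> borel_measurable borel"
    by (rule measurable_compose[OF _ borel_measurable_solenoid_lift_iterate])
       (intro borel_measurable_continuous_onI continuous_intros)
  ultimately have "(\<lambda>t. indicator ?D ((solenoid_lift a ^^ m) (t, 0)) *\<^sub>R
      \<phi> (solenoid_chart ((solenoid_lift a ^^ m) (t, 0)))) \<in> borel_measurable borel"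
    by (rule measurable_compose[rotated])
  then show ?thesis
    using central_observable_in_disk[of m a] by (simp add: central_observable_def[abs_def])
qed

text \<open>The excluded points are those whose orbit meets the discontinuity \<open>1/2\<close>
  before time \<open>m\<close>.\<close>

lemma tendsto_central_observable:
  assumes \<phi>: "continuous_on solid_torus \<phi>" and A: "(A \<longlongrightarrow> a) F" and a: "0 < a"
    and X: "(X \<longlongrightarrow> x) F" and x: "x \<in> {0<..<1} - (\<Union>j<m. {x \<in> {0..<1}. (intermittent_branch a ^^ j) x \<in> {1/2}})"
  shows "((\<lambda>k. central_observable \<phi> (A k) m (X k)) \<longlongrightarrow> central_observable \<phi> a m x) F"
  unfolding central_observable_def
proof (rule continuous_on_tendsto_compose[OF continuous_on_chart_observable[OF \<phi>]])
  show "((\<lambda>k. (solenoid_lift (A k) ^^ m) (X k, 0)) \<longlongrightarrow> (solenoid_lift a ^^ m) (x, 0)) F"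
    using x by (intro tendsto_solenoid_lift_iterate A a tendsto_Pair X tendsto_const) auto
qed (auto simp only: central_observable_in_disk intro!: always_eventually)

text \<open>The contraction rate \<open>1/5\<close> is independent of \<open>a\<close>, so a single
  \<open>m\<close> with \<open>(1/5) ^ m\<close> below the modulus of uniform continuity serves all
  positive parameters.\<close>

lemma central_observable_close:
  assumes \<phi>: "continuous_on solid_torus \<phi>" and e: "0 < (e::real)"
  obtains m where "\<And>a p. 0 < a \<Longrightarrow> p \<in> solid_torus \<Longrightarrow>
    \<bar>\<phi> ((solenoid_map a ^^ m) p) - central_observable \<phi> a m (circle_coord (fst p))\<bar> < e"
proof -
  obtain d where d: "0 < d" "\<And>x v w. norm v \<le> 1 \<Longrightarrow> norm w \<le> 1 \<Longrightarrow> dist v w < d \<Longrightarrow> \<bar>\<phi> (x, v) - \<phi> (x, w)\<bar> < e"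
    using uniform_fibre_continuity[OF \<phi> e] by blast
  obtain m where m: "(1/5 :: real) ^ m < d" using real_arch_pow_inv[OF d(1), of "1/5"] by auto
  show ?thesis
  proof (rule that[of m])
    fix a :: real and p :: "circle \<times> real \<times> real"
    assume a: "0 < a" and p: "p \<in> solid_torus"
    obtain x v where xv: "p = (x, v)" by (cases p)
    let ?P = "(solenoid_map a ^^ m) (x, v)" and ?Q = "(solenoid_map a ^^ m) (x, 0)"
    have v: "norm v \<le> 1" using p by (simp add: xv mem_solid_torus)
    have PQ: "?P \<in> solid_torus" "?Q \<in> solid_torus"
      using v by (intro solenoid_map_iterate_in_solid_torus; simp add: mem_solid_torus)+
    have "dist (snd ?P) (snd ?Q) = (1/5) ^ m * norm v"
      using solenoid_map_iterate_fibre[of m a x v 0] by (simp add: dist_norm)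
    also have "\<dots> \<le> (1/5) ^ m" using v by (simp add: mult_left_le)
    finally have "dist (snd ?P) (snd ?Q) < d" using m by simp
    moreover have "fst ?P = fst ?Q" using solenoid_map_iterate_fibre[of m a x v 0] by simp
    ultimately have "\<bar>\<phi> ?P - \<phi> ?Q\<bar> < e"
      using d(2)[of "snd ?P" "snd ?Q" "fst ?P"] PQ
      by (metis mem_solid_torus prod.collapse)
    moreover have "\<phi> ?Q = central_observable \<phi> a m (circle_coord x)"
    proof -
      have "(x, 0) = solenoid_chart (circle_coord x, 0)" by (simp add: solenoid_chart_def circle_of_coord)
      then show ?thesis
        unfolding central_observable_def
        using solenoid_map_chart_iterate[OF a, of "(circle_coord x, 0)" m] circle_coord_ge_0[of x] circle_coord_less_1[of x]
        by simp
    qed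
    ultimately show "\<bar>\<phi> ((solenoid_map a ^^ m) p) - central_observable \<phi> a m (circle_coord (fst p))\<bar> < e"
      by (simp add: xv)
  qed
qed

text \<open>Invariance permits evaluating \<open>\<phi>\<close> along the \<open>m\<close>-th
  iterate without changing its integral. The central observable sees the base point alone, so its
  integral descends to the projected measure \<open>\<nu>\<close>.\<close>

lemma solenoid_integral_close:
  assumes \<phi>: "continuous_on solid_torus \<phi>" and a: "0 < a" and \<nu>: "acip a \<nu>" and \<theta>: "solenoid_SRB a \<nu> \<theta>"
    and close: "\<And>p. p \<in> solid_torus \<Longrightarrow>
      \<bar>\<phi> ((solenoid_map a ^^ m) p) - central_observable \<phi> a m (circle_coord (fst p))\<bar> < e"
    and B: "\<And>p. p \<in> solid_torus \<Longrightarrow> \<bar>\<phi> p\<bar> \<le> B"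
  shows "\<bar>(\<integral>p. \<phi> p \<partial>\<theta>) - (\<integral>t. central_observable \<phi> a m t \<partial>distr \<nu> borel circle_coord)\<bar> \<le> e"
proof -
  have s\<theta>: "sets \<theta> = sets (restrict_space borel solid_torus)" and inv: "invariant_measure (solenoid_map a) \<theta>"
    and d\<theta>: "distr \<theta> borel fst = \<nu>" and "prob_space \<theta>"
    using \<theta> by (auto simp: solenoid_SRB_def)
  then interpret prob_space \<theta> by simp
  have sp: "space \<theta> = solid_torus" using sets_eq_imp_space_eq[OF s\<theta>] by (simp add: space_restrict_space)
  note mb = measurable_cong_sets[OF s\<theta> refl]
  have \<phi>m: "\<phi> \<in> borel_measurable \<theta>"
    unfolding mb by (rule borel_measurable_continuous_on_restrict[OF \<phi>])
  have fstm [measurable]: "fst \<in> measurable \<theta> borel"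
    unfolding mb by (intro borel_measurable_continuous_on_restrict continuous_intros)
  note [measurable] = borel_measurable_central_observable[OF \<phi>]
  let ?V = "\<lambda>p. \<phi> ((solenoid_map a ^^ m) p)" and ?W = "\<lambda>p. central_observable \<phi> a m (circle_coord (fst p))"
  have V: "?V \<in> borel_measurable \<theta>" "(\<integral>p. ?V p \<partial>\<theta>) = (\<integral>p. \<phi> p \<partial>\<theta>)"
    using invariant_integral_iterate[OF inv \<phi>m] by auto
  have W: "(\<integral>p. ?W p \<partial>\<theta>) = (\<integral>t. central_observable \<phi> a m t \<partial>distr \<nu> borel circle_coord)"
  proof -
    have [measurable_cong]: "sets \<nu> = sets borel" using \<nu> by (simp add: acip_def)
    have "(\<integral>t. central_observable \<phi> a m t \<partial>distr \<nu> borel circle_coord) =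
        (\<integral>x. central_observable \<phi> a m (circle_coord x) \<partial>distr \<theta> borel fst)"
      unfolding d\<theta> by (subst integral_distr) auto
    then show ?thesis by (subst (asm) (2) integral_distr) auto
  qed
  have cB: "\<bar>central_observable \<phi> a m t\<bar> \<le> B" for t
    unfolding central_observable_def
    by (rule B) (simp only: solenoid_chart_in_solid_torus central_observable_in_disk)
  have "integrable \<theta> ?V"
  proof (rule integrable_const_bound[where B=B])
    show "AE p in \<theta>. norm (?V p) \<le> B"
      unfolding real_norm_def by (intro AE_I2 B solenoid_map_iterate_in_solid_torus) (simp add: sp)
  qed (rule V(1))
  moreover have "integrable \<theta> ?W"
    using cB by (intro integrable_const_bound[where B=B]) auto
  ultimately have "\<bar>(\<integral>p. ?V p \<partial>\<theta>) - (\<integral>p. ?W p \<partial>\<theta>)\<bar> \<le> (\<integral>p. \<bar>?V p - ?W p\<bar> \<partial>\<theta>)"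
    and "integrable \<theta> (\<lambda>p. \<bar>?V p - ?W p\<bar>)"
    using integral_abs_bound[of \<theta> "\<lambda>p. ?V p - ?W p"] by auto
  moreover have "(\<integral>p. \<bar>?V p - ?W p\<bar> \<partial>\<theta>) \<le> e"
    using calculation(2) close by (intro integral_le_const AE_I2) (auto simp: sp less_imp_le)
  ultimately show ?thesis using V(2) W by simp
qed

theorem theorem2:
  fixes \<mu> :: "real \<Rightarrow> circle measure"
    and \<eta> :: "real \<Rightarrow> (circle \<times> real \<times> real) measure"
    and \<alpha> :: "nat \<Rightarrow> real" and \<alpha>\<^sub>0 :: real
    and \<phi> :: "circle \<times> real \<times> real \<Rightarrow> real"
  assumes "\<And>a. 0 < a \<Longrightarrow> a < 1 \<Longrightarrow> circle_SRB a (\<mu> a)"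
    and "\<And>a. 0 < a \<Longrightarrow> a < 1 \<Longrightarrow> solenoid_SRB a (\<mu> a) (\<eta> a)"
    and "0 < \<alpha>\<^sub>0" "\<alpha>\<^sub>0 < 1"
    and "\<And>n. n \<ge> 1 \<Longrightarrow> 0 < \<alpha> n \<and> \<alpha> n < 1"
    and "\<alpha> \<longlonglongrightarrow> \<alpha>\<^sub>0"
    and "continuous_on solid_torus \<phi>"
  shows "(\<lambda>n. \<integral>p. \<phi> p \<partial>\<eta> (\<alpha> n)) \<longlonglongrightarrow> (\<integral>p. \<phi> p \<partial>\<eta> \<alpha>\<^sub>0)"
proof -
  note SRB = assms(1) and \<theta> = assms(2) and \<alpha>0 = assms(3,4) and \<phi> = assms(7)
  have acip: "acip a (\<mu> a)" if "0 < a" "a < 1" for a using SRB[OF that] by (simp add: circle_SRB_def)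
  obtain B where B: "\<bar>\<phi> p\<bar> \<le> B" if "p \<in> solid_torus" for p
    using compact_imp_bounded[OF compact_continuous_image[OF \<phi> compact_solid_torus]]
    by (auto simp: bounded_iff)
  have cB: "\<bar>central_observable \<phi> a m t\<bar> \<le> B" for a m t
    unfolding central_observable_def
    by (rule B) (simp only: solenoid_chart_in_solid_torus central_observable_in_disk)
  \<comment> \<open>The midpoint of \<open>\<alpha>\<^sub>0\<close> and 1 leaves room for nearby
    parameters while keeping the majorant integrable.\<close>
  define b where "b = (1 + \<alpha>\<^sub>0) / 2"
  have b: "\<alpha>\<^sub>0 < b" "b < 1" using \<alpha>0 by (auto simp: b_def)
  have "\<forall>\<^sub>F n in sequentially. \<alpha> n < b \<and> 1 \<le> n"
    using order_tendstoD(2)[OF assms(6) b(1)] eventually_ge_at_top[of 1] by (rule eventually_conj)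
  \<comment> \<open>The condition \<open>1 \<le> n\<close> is included because nothing is assumed
    about \<open>\<alpha> 0\<close>; the sequence is then shifted by \<open>N\<close>.\<close>
  then obtain N where N: "\<And>n. N \<le> n \<Longrightarrow> \<alpha> n < b \<and> 1 \<le> n"
    unfolding eventually_sequentially by blast
  define A where "A k = \<alpha> (k + N)" for k
  have A: "0 < A k" "A k \<le> b" "A k < 1" for k
    using N[of "k + N"] assms(5)[of "k + N"] b by (auto simp: A_def)
  have A_lim: "A \<longlonglongrightarrow> \<alpha>\<^sub>0" unfolding A_def using assms(6) by (rule LIMSEQ_ignore_initial_segment)
  define m where "m a = distr (\<mu> a) borel circle_coord" for a
  have m: "real_distribution (m a)" if "0 < a" "a < 1" for a
    unfolding m_def using acip[OF that] by (rule real_distribution_circle_coord)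
  have m_le: "m (A k) \<le> majorant_measure b" for k
    unfolding m_def by (rule acip_le_majorant[OF A(1,2) b(2) SRB[OF A(1,3)]])
  have conv: "weak_conv_m (\<lambda>k. m (A k)) (m \<alpha>\<^sub>0)"
    unfolding m_def[of \<alpha>\<^sub>0]
  proof (rule circle_stability[OF \<alpha>0(1) b(2) SRB[OF \<alpha>0] A_lim m[OF A(1,3)] m_le])
    fix g :: "real \<Rightarrow> real" assume "continuous_on UNIV g"
    then have "g \<in> borel_measurable borel" by (rule borel_measurable_continuous_onI)
    \<comment> \<open>Each SRB measure is exactly invariant under its own map, so every term of the
      sequence is 0.\<close>
    then show "(\<lambda>k. (\<integral>x. g (intermittent_branch (A k) x) \<partial>m (A k)) - (\<integral>x. g x \<partial>m (A k))) \<longlonglongrightarrow> 0"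
      using acip_coord_integral[OF A(1) acip[OF A(1,3)]] by (simp add: m_def)
  qed
  have base: "(\<lambda>k. \<integral>t. central_observable \<phi> (A k) j t \<partial>m (A k)) \<longlonglongrightarrow> (\<integral>t. central_observable \<phi> \<alpha>\<^sub>0 j t \<partial>m \<alpha>\<^sub>0)" for j
  proof (rule weak_conv_dominated_integral[OF m[OF A(1,3)] m[OF \<alpha>0] conv sets_majorant_measure
        finite_measure_majorant_measure[OF b(2)] m_le])
    let ?Z = "\<Union>i<j. {x \<in> {0..<1}. (intermittent_branch \<alpha>\<^sub>0 ^^ i) x \<in> {1/2}}"
    have "finite ?Z" using finite_intermittent_branch_preimage[OF \<alpha>0(1), of "{1/2}"] by blast
    then have AE: "AE x in majorant_measure b. x \<in> {0<..<1} - ?Z" by (rule AE_majorant_measure_finite)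
    show "AE x in majorant_measure b. (\<lambda>k. central_observable \<phi> (A k) j x) \<longlonglongrightarrow> central_observable \<phi> \<alpha>\<^sub>0 j x"
      using AE by (rule eventually_mono) (rule tendsto_central_observable[OF \<phi> A_lim \<alpha>0(1) tendsto_const])
    show "AE x in majorant_measure b. isCont (central_observable \<phi> \<alpha>\<^sub>0 j) x"
      using AE unfolding isCont_def
      by (rule eventually_mono) (rule tendsto_central_observable[OF \<phi> tendsto_const \<alpha>0(1) tendsto_ident_at])
  qed (use cB \<phi> in auto)
  have "(\<lambda>k. \<integral>p. \<phi> p \<partial>\<eta> (A k)) \<longlonglongrightarrow> (\<integral>p. \<phi> p \<partial>\<eta> \<alpha>\<^sub>0)"
  proof (rule LIMSEQ_I)
    fix e :: real assume "0 < e"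
    \<comment> \<open>One third each for passing to the base at \<open>A k\<close>, for the
      convergence there, and for returning at \<open>\<alpha>\<^sub>0\<close>. The index
      \<open>j\<close> is fixed before \<open>k\<close>, which its uniformity in the parameter
      permits.\<close>
    then have "0 < e / 3" by simp
    from central_observable_close[OF \<phi> this] obtain j where j: "\<And>a p. 0 < a \<Longrightarrow> p \<in> solid_torus \<Longrightarrow>
        \<bar>\<phi> ((solenoid_map a ^^ j) p) - central_observable \<phi> a j (circle_coord (fst p))\<bar> < e / 3"
      by blast
    have close: "\<bar>(\<integral>p. \<phi> p \<partial>\<eta> a) - (\<integral>t. central_observable \<phi> a j t \<partial>m a)\<bar> \<le> e / 3" if "0 < a" "a < 1" for a
      unfolding m_def using solenoid_integral_close[OF \<phi> that(1) acip[OF that] \<theta>[OF that] j[OF that(1)] B] .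
    obtain k0 where k0: "\<And>k. k0 \<le> k \<Longrightarrow>
        \<bar>(\<integral>t. central_observable \<phi> (A k) j t \<partial>m (A k)) - (\<integral>t. central_observable \<phi> \<alpha>\<^sub>0 j t \<partial>m \<alpha>\<^sub>0)\<bar> < e / 3"
      using LIMSEQ_D[OF base[of j] \<open>0 < e / 3\<close>] by auto
    show "\<exists>k0. \<forall>k\<ge>k0. norm ((\<integral>p. \<phi> p \<partial>\<eta> (A k)) - (\<integral>p. \<phi> p \<partial>\<eta> \<alpha>\<^sub>0)) < e"
    proof (intro exI allI impI)
      fix k assume "k0 \<le> k"
      then show "norm ((\<integral>p. \<phi> p \<partial>\<eta> (A k)) - (\<integral>p. \<phi> p \<partial>\<eta> \<alpha>\<^sub>0)) < e"
        using k0[of k] close[OF A(1,3), of k] close[OF \<alpha>0] unfolding real_norm_def by linarith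
    qed
  qed
  then show ?thesis unfolding A_def by (rule LIMSEQ_offset)
qed

end
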